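(* The change-of-basis DA bimodules $\mathcal K$ over $(\mathcal A^{\rm can}_{1,1},\mathcal A_{1,1})$ and $\mathcal L$ over $(\mathcal A_{1,1},\mathcal A^{\rm can}_{1,1})$ given in the context are well-defined (they satisfy the DA bimodule relations), and are homotopy inverses: $\mathcal K\boxtimes\mathcal L\simeq\mathbb I_{\mathcal A^{\rm can}_{1,1}}$ and $\mathcal L\boxtimes\mathcal K\simeq\mathbb I_{\mathcal A_{1,1}}$. They categorify the change-of-basis matrices between the tensor-product basis and the canonical basis of $V^{\otimes2}$: identifying $[S_{\mathrm{uu}}],[S_{\mathrm{ou}}],[S_{\mathrm{uo}}],[S_{\mathrm{oo}}]$ with $|00\rangle,|10\rangle,|01\rangle,|11\rangle$ and $[S_\varnothing],[S_A],[S_B],[S_{AB}]$ with $\ell_2\wedge\ell_1,\ell_2,\ell_1,1$, the map $[{}^\vee\mathcal K]:G_0(\mathcal A^{\rm can}_{1,1})\to G_0(\mathcal A_{1,1})$ is the change-of-basis matrix from the canonical basis to the standard basis, and $[{}^\vee\mathcal L]:G_0(\mathcal A_{1,1})\to G_0(\mathcal A_{1,1}^{\rm can})$ is the change-of-basis matrix from the standard basis to the canonical basis: $$[{}^\vee\mathcal K]=\begin{pmatrix}1&0&0&0\\0&1&0&0\\0&q&1&0\\0&0&0&1\end{pmatrix},\qquad[{}^\vee\mathcal L]=\begin{pmatrix}1&0&0&0\\0&1&0&0\\0&-q&1&0\\0&0&0&1\end{pmatrix}.$$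
   Context: **Conventions.** Ground field $\mathbb F_2$. Everything is bigraded by $(\deg^q,\deg^h)\in\mathbb Z^2$; products and actions have bidegree $(0,0)$, differentials $(0,1)$. $q^iW[j]$: $\deg^q$ shifted up by $i$, $\deg^h$ shifted down by $j$. Bidegrees are written $(\deg^q,\deg^h)$. For a dg category $A$ put $A(T,S)=\mathrm{Hom}_A(S,T)$, products being compositions; $I\subset A$ is the subcategory of identity morphisms; $A$ is augmented over $I$ (non-identity basis elements map to $0$) with kernel $A_+$. **DA bimodules.** A DA bimodule over $(A',A)$ is an $(I',I)$-bimodule $M$ (a family $M(S',S)$) with bidegree-zero bilinear maps $\delta^1_i:M\otimes_I(A[1])^{\otimes(i-1)}\to A'[1]\otimes_{I'}M$, $i\ge1$, such that for all $i$ $$\sum_{j=1}^i(\mu'\otimes\mathrm{id})(\mathrm{id}\otimes\delta^1_{i-j+1})(\delta^1_j\otimes\mathrm{id})+\sum_{j=1}^{i-1}\delta^1_i(\mathrm{id}\otimes\partial_j)+\sum_{j=1}^{i-2}\delta^1_{i-1}(\mathrm{id}\otimes\mu_{j,j+1})+(\partial'\otimes\mathrm{id})\delta^1_i=0,$$ strictly unital ($\delta^1_2(m,\mathrm{id})=\mathrm{id}\otimes m$, and $\delta^1_i=0$ if $i>2$ and an input is an identity). Write $\delta(m;a_1,\dots,a_n)=a'm'$ for $\delta^1_{n+1}(m\otimes a_1\otimes\cdots\otimes a_n)=a'\otimes m'$ ($\delta(m)$ when $n=0$); unlisted operations on non-identity basis inputs are zero; $k,l\ge0$ arbitrary. A morphism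 $f:M\to N$ is a collection $f_i:M\otimes(A_+[1])^{\otimes(i-1)}\to A'\otimes N$, with differential $$d(f)_i=\sum_j(\mu'\otimes\mathrm{id})(\mathrm{id}\otimes\delta^1_{i-j+1})f_j+\sum_j(\mu'\otimes\mathrm{id})(\mathrm{id}\otimes f_{i-j+1})\delta^1_j+\sum_jf_i(\mathrm{id}\otimes\partial_j)+\sum_jf_{i-1}(\mathrm{id}\otimes\mu_{j,j+1})+(\partial'\otimes\mathrm{id})f_i;$$ composition $gf=\sum(\mu'\otimes\mathrm{id})(\mathrm{id}\otimes g)(f\otimes\mathrm{id})$; $\simeq$ is homotopy equivalence (bidegree zero) in this dg category. Box product: $M\boxtimes N$ is $M\otimes_{I'}N$ with operations $\sum_j(\delta^{1,M}_{j+1}\otimes\mathrm{id})(\mathrm{id}\otimes\delta^{j,N})$, $\delta^{j,N}$ the $j$-fold iterate of $\delta^{1,N}$. The identity DA bimodule $\mathbb I_A$ has basis $\mathbf I_S\in\mathbb I_A(S,S)$, $\delta(\mathbf I_T;a)=a\,\mathbf I_S$ for $a\in A(T,S)$. **Duals and decategorification.** For finitely generated DA $M$ over $(A',A)$, the left dual ${}^\vee M$ is the AD bimodule (definition with left and right interchanged) over $(A,A')$ with ${}^\vee M(S,S')=M(S',S)^*$ (bidegrees negated) and transposed operations. $G_0(A)$ is the $\mathbb C(q)$-vector space with basis $[S_s]$, $s$ an object of $A$; an AD bimodule $N$ over $(A',A)$ induces $[N]:G_0(A)\to G_0(A')$ with entry $\sum(-1)^{\deg^h}q^{\deg^q}$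 over a homogeneous basis of $N(s',s)$ in row $[S_{s'}]$, column $[S_s]$. **Algebras.** $\mathcal A_{1,1}$: objects $\mathrm{uu},\mathrm{ou},\mathrm{uo},\mathrm{oo}$ with endomorphism algebras $\mathbb F_2,\mathbb F_2[U_1],\mathbb F_2[U_2],\mathbb F_2[U_1,U_2]$; $\mathcal A_{1,1}(\mathrm{uo},\mathrm{ou})=\mathbb F_2\lambda$, $\lambda U_1=0=U_2\lambda$; no other morphisms; $U_i$ of bidegree $(-2,2)$, $\lambda$ of bidegree $(1,0)$; zero differential. $\mathcal A_{1,1}^{\rm can}$ (an Ozsváth–Szabó algebra): objects $\varnothing,A,B,AB$; $\mathrm{End}(\varnothing)=\mathbb F_2$, $\mathrm{End}(AB)=\mathbb F_2[U_1,U_2]$; on the objects $A,B$ it is generated by $R_1\in\mathcal A^{\rm can}_{1,1}(A,B)$, $L_1\in\mathcal A^{\rm can}_{1,1}(B,A)$ and $U_2\in\mathcal A^{\rm can}_{1,1}(B,B)$ with relations $R_1U_2=0$, $U_2L_1=0$; one writes $U_1=R_1L_1$ at $A$ and $U_1=L_1R_1$ at $B$; so a basis is: $U_1^k$ at $A$; $1,U_1^{k+1},U_2^{k+1}$ at $B$; $R_1U_1^k$; $L_1U_1^k$. No other morphisms; zero differential; $R_1,L_1$ of bidegree $(-1,1)$, $U_i$ of bidegree $(-2,2)$. **$\mathcal K$** (over $(\mathcal A^{\rm can}_{1,1},\mathcal A_{1,1})$): basis $\kappa_1\in\mathcal K(\varnothing,\mathrm{uu})$, $\kappa_2\in\mathcal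 K(A,\mathrm{ou})$, $\kappa_3\in\mathcal K(A,\mathrm{uo})$, $\kappa_4\in\mathcal K(B,\mathrm{uo})$, $\kappa_5\in\mathcal K(AB,\mathrm{oo})$; $\kappa_3$ of bidegree $(-1,0)$, others $(0,0)$. Operations: $\delta(\kappa_2;U_1^{k+1})=U_1^{k+1}\kappa_2$; $\delta(\kappa_3)=R_1\kappa_4$; $\delta(\kappa_3;\lambda)=\kappa_2$; $\delta(\kappa_4;U_2^{k+1})=U_2^{k+1}\kappa_4$; $\delta(\kappa_4;\lambda,U_1^{k+1})=L_1U_1^k\kappa_2$; $\delta(\kappa_5;U_1^kU_2^l)=U_1^kU_2^l\kappa_5$. **$\mathcal L$** (over $(\mathcal A_{1,1},\mathcal A^{\rm can}_{1,1})$): basis $\lambda_1\in\mathcal L(\mathrm{uu},\varnothing)$, $\lambda_2\in\mathcal L(\mathrm{ou},A)$, $\lambda_3\in\mathcal L(\mathrm{ou},B)$, $\lambda_4\in\mathcal L(\mathrm{uo},B)$, $\lambda_5\in\mathcal L(\mathrm{oo},AB)$; $\lambda_3$ of bidegree $(-1,1)$, others $(0,0)$. Operations: $\delta(\lambda_2;U_1^{k+1})=U_1^{k+1}\lambda_2$; $\delta(\lambda_2;R_1U_1^k)=U_1^k\lambda_3$; $\delta(\lambda_3;L_1U_1^k)=U_1^{k+1}\lambda_2$; $\delta(\lambda_3;U_1^{k+1})=U_1^{k+1}\lambda_3$; $\delta(\lambda_4)=\lambda\,\lambda_3$; $\delta(\lambda_4;U_2^{k+1})=U_2^{k+1}\lambda_4$;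 $\delta(\lambda_5;U_1^kU_2^l)=U_1^kU_2^l\lambda_5$. **Canonical basis.** Identify $V^{\otimes2}$ ($V$ with basis $|0\rangle,|1\rangle$) with the exterior algebra on $e_1,e_2$ over $\mathbb C(q)$ via $|00\rangle=e_2\wedge e_1$, $|10\rangle=e_2$, $|01\rangle=e_1$, $|11\rangle=1$. With $\ell_1=e_1$, $\ell_2=qe_1+e_2$, the canonical basis is $\ell_2\wedge\ell_1,\ell_2,\ell_1,1$; the standard (tensor-product) basis is $|00\rangle,|10\rangle,|01\rangle,|11\rangle$. *)

theory Defs
  imports
    "HOL-Analysis.Analysis"
    "HOL-Library.Z2"
    "HOL-Library.Poly_Mapping"
    "HOL-Library.Groups_Big_Fun"
    "HOL-Computational_Algebra.Fraction_Field"
begin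

section \<open>Based vector spaces over the field with two elements\<close>

text \<open>Every bigraded space below comes with a homogeneous basis, and \<open>'b \<Rightarrow>\<^sub>0 bit\<close> is the
  \<open>\<F>\<^sub>2\<close>-vector space with basis \<open>'b\<close>.  A linear map is given by its values on the
  basis.  The only nonzero scalar is 1, hence no coefficients in \<open>lin\<close>.\<close>

type_synonym 'b f2 = "'b \<Rightarrow>\<^sub>0 bit"
type_synonym bideg = "int \<times> int"  \<comment> \<open>(q-degree, h-degree)\<close>

definition bas :: "'b \<Rightarrow> 'b f2" where
  "bas x = Poly_Mapping.single x 1"

definition lin :: "('b \<Rightarrow> 'c f2) \<Rightarrow> 'b f2 \<Rightarrow> 'c f2" where
  "lin f v = (\<Sum>x\<in>Poly_Mapping.keys v. f x)"


section \<open>Bigraded dg categories\<close>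

text \<open>The type \<open>'o\<close> is the set of objects.  A basis element \<open>a\<close> lies in
  \<open>A(tgt a, src a) = Hom(src a, tgt a)\<close>, so \<open>a b\<close> is composable if \<open>src a = tgt b\<close>;
  \<open>dg_mult\<close> is relevant only on composable pairs.\<close>

record ('o, 'b) dgcat =
  dg_basis :: "'b set"
  dg_tgt :: "'b \<Rightarrow> 'o"
  dg_src :: "'b \<Rightarrow> 'o"
  dg_deg :: "'b \<Rightarrow> bideg"
  dg_id :: "'o \<Rightarrow> 'b"
  dg_mult :: "'b \<Rightarrow> 'b \<Rightarrow> 'b f2"
  dg_diff :: "'b \<Rightarrow> 'b f2"

definition dg_hom :: "('o, 'b) dgcat \<Rightarrow> 'o \<Rightarrow> 'o \<Rightarrow> 'b set" where
  "dg_hom A T S = {a \<in> dg_basis A. dg_tgt A a = T \<and> dg_src A a = S}"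

text \<open>Non-identity basis elements; they span the augmentation ideal \<open>A\<^sub>+\<close>.\<close>
definition dg_plus :: "('o, 'b) dgcat \<Rightarrow> 'b set" where
  "dg_plus A = dg_basis A - range (dg_id A)"

text \<open>The last two conditions say that the map sending identities to identities and all other
  basis elements to 0 is a dg functor to the category of identity morphisms.\<close>
definition dg_category :: "('o, 'b) dgcat \<Rightarrow> bool" where
  "dg_category A \<longleftrightarrow>
     (\<forall>S. dg_id A S \<in> dg_hom A S S \<and> dg_deg A (dg_id A S) = (0, 0)) \<and>
     (\<forall>a\<in>dg_basis A. \<forall>b\<in>dg_basis A. dg_src A a = dg_tgt A b \<longrightarrow>
        (\<forall>c\<in>Poly_Mapping.keys (dg_mult A a b).
           c \<in> dg_hom A (dg_tgt A a) (dg_src A b) \<and> dg_deg A c = dg_deg A a + dg_deg A b)) \<and>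
     (\<forall>a\<in>dg_basis A. \<forall>c\<in>Poly_Mapping.keys (dg_diff A a).
        c \<in> dg_hom A (dg_tgt A a) (dg_src A a) \<and> dg_deg A c = dg_deg A a + (0, 1)) \<and>
     (\<forall>a\<in>dg_basis A. dg_mult A (dg_id A (dg_tgt A a)) a = bas a \<and>
                      dg_mult A a (dg_id A (dg_src A a)) = bas a) \<and>
     (\<forall>a\<in>dg_basis A. \<forall>b\<in>dg_basis A. \<forall>c\<in>dg_basis A.
        dg_src A a = dg_tgt A b \<longrightarrow> dg_src A b = dg_tgt A c \<longrightarrow>
        lin (\<lambda>x. dg_mult A x c) (dg_mult A a b) = lin (\<lambda>x. dg_mult A a x) (dg_mult A b c)) \<and>
     (\<forall>a\<in>dg_basis A. lin (dg_diff A) (dg_diff A a) = 0) \<and>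
     (\<forall>a\<in>dg_basis A. \<forall>b\<in>dg_basis A. dg_src A a = dg_tgt A b \<longrightarrow>
        lin (dg_diff A) (dg_mult A a b) =
          lin (\<lambda>x. dg_mult A x b) (dg_diff A a) + lin (\<lambda>x. dg_mult A a x) (dg_diff A b)) \<and>
     (\<forall>a\<in>dg_basis A. \<forall>b\<in>dg_basis A. dg_src A a = dg_tgt A b \<longrightarrow>
        a \<in> dg_plus A \<or> b \<in> dg_plus A \<longrightarrow>
        Poly_Mapping.keys (dg_mult A a b) \<subseteq> dg_plus A) \<and>
     (\<forall>a\<in>dg_basis A. Poly_Mapping.keys (dg_diff A a) \<subseteq> dg_plus A)"

text \<open>\<open>dg_chain A S [a\<^sub>1, \<dots>, a\<^sub>n] T\<close>: the tensor \<open>a\<^sub>1 \<otimes> \<dots> \<otimes> a\<^sub>n\<close> is a basis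
  element of \<open>A(S, S\<^sub>1) \<otimes> A(S\<^sub>1, S\<^sub>2) \<otimes> \<dots> \<otimes> A(S\<^sub>n\<^sub>-\<^sub>1, T)\<close>, a summand of the tensor power over
  the identity morphisms.\<close>
fun dg_chain :: "('o, 'b) dgcat \<Rightarrow> 'o \<Rightarrow> 'b list \<Rightarrow> 'o \<Rightarrow> bool" where
  "dg_chain A S [] T \<longleftrightarrow> S = T"
| "dg_chain A S (a # as) T \<longleftrightarrow>
     a \<in> dg_basis A \<and> dg_tgt A a = S \<and> dg_chain A (dg_src A a) as T"

text \<open>Bidegree of \<open>a\<^sub>1 \<otimes> \<dots> \<otimes> a\<^sub>n\<close> in the n-th tensor power of \<open>A[1]\<close>.\<close>
definition dg_shifted_deg :: "('o, 'b) dgcat \<Rightarrow> 'b list \<Rightarrow> bideg" where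
  "dg_shifted_deg A as = sum_list (map (dg_deg A) as) - (0, int (length as))"


section \<open>DA bimodules\<close>

text \<open>An element \<open>x\<close> of \<open>da_gens M\<close> is a basis element of \<open>M(da_left x, da_right x)\<close>, and
  \<open>da_delta M x [a\<^sub>1, \<dots>, a\<^sub>n]\<close> is the value of the operation with \<open>n\<close> algebra inputs
  (\<open>\<delta>\<close> with upper index 1, lower index \<open>n + 1\<close>).  A pair \<open>(a', x')\<close> stands
  for \<open>a' \<otimes> x'\<close>.\<close>

type_synonym ('m, 'a, 'c, 'n) multi_map = "'m \<Rightarrow> 'a list \<Rightarrow> ('c \<times> 'n) f2"

record ('p, 'o, 'c, 'a, 'm) da =
  da_gens :: "'m set"
  da_left :: "'m \<Rightarrow> 'p"
  da_right :: "'m \<Rightarrow> 'o"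
  da_deg :: "'m \<Rightarrow> bideg"
  da_delta :: "('m, 'a, 'c, 'm) multi_map"

text \<open>\<open>\<Sum>\<^sub>j (\<mu>' \<otimes> id)(id \<otimes> g\<^sub>i\<^sub>-\<^sub>j\<^sub>+\<^sub>1)(f\<^sub>j \<otimes> id)\<close>: \<open>f\<close> takes the first inputs, \<open>g\<close> the
  remaining ones, and the outputs in \<open>A'\<close> are multiplied.\<close>
definition mm_comp ::
  "('p, 'c) dgcat \<Rightarrow> ('n, 'a, 'c, 'k) multi_map \<Rightarrow> ('m, 'a, 'c, 'n) multi_map
     \<Rightarrow> ('m, 'a, 'c, 'k) multi_map" where
  "mm_comp A' g f x as =
     (\<Sum>p\<le>length as.
        lin (\<lambda>(c, y). lin (\<lambda>(c', z). lin (\<lambda>b. bas (b, z)) (dg_mult A' c c')) (g y (drop p as)))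
          (f x (take p as)))"

text \<open>\<open>\<Sum>\<^sub>j f(id \<otimes> \<partial>\<^sub>j)\<close>, \<open>\<Sum>\<^sub>j f(id \<otimes> \<mu>\<^sub>j\<^sub>,\<^sub>j\<^sub>+\<^sub>1)\<close> and \<open>(\<partial>' \<otimes> id) f\<close>, respectively.\<close>
definition mm_diff_in ::
  "('o, 'a) dgcat \<Rightarrow> ('m, 'a, 'c, 'n) multi_map \<Rightarrow> ('m, 'a, 'c, 'n) multi_map" where
  "mm_diff_in A f x as = (\<Sum>j<length as. lin (\<lambda>b. f x (as[j := b])) (dg_diff A (as ! j)))"

definition mm_mult_in ::
  "('o, 'a) dgcat \<Rightarrow> ('m, 'a, 'c, 'n) multi_map \<Rightarrow> ('m, 'a, 'c, 'n) multi_map" where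
  "mm_mult_in A f x as =
     (\<Sum>j<length as - 1.
        lin (\<lambda>b. f x (take j as @ b # drop (j + 2) as)) (dg_mult A (as ! j) (as ! (j + 1))))"

definition mm_diff_out ::
  "('p, 'c) dgcat \<Rightarrow> ('m, 'a, 'c, 'n) multi_map \<Rightarrow> ('m, 'a, 'c, 'n) multi_map" where
  "mm_diff_out A' f x as = lin (\<lambda>(c, y). lin (\<lambda>b. bas (b, y)) (dg_diff A' c)) (f x as)"

definition da_bimodule ::
  "('p, 'c) dgcat \<Rightarrow> ('o, 'a) dgcat \<Rightarrow> ('p, 'o, 'c, 'a, 'm) da \<Rightarrow> bool" where
  "da_bimodule A' A M \<longleftrightarrow>
     dg_category A' \<and> dg_category A \<and>
     \<comment> \<open>bidegree-zero bimodule maps into \<open>A'[1] \<otimes> M\<close>\<close>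
     (\<forall>x\<in>da_gens M. \<forall>as T. dg_chain A (da_right M x) as T \<longrightarrow>
        (\<forall>(c, y)\<in>Poly_Mapping.keys (da_delta M x as).
           y \<in> da_gens M \<and> c \<in> dg_hom A' (da_left M x) (da_left M y) \<and> da_right M y = T \<and>
           da_deg M x + dg_shifted_deg A as = dg_shifted_deg A' [c] + da_deg M y)) \<and>
     \<comment> \<open>structure relations\<close>
     (\<forall>x\<in>da_gens M. \<forall>as T. dg_chain A (da_right M x) as T \<longrightarrow>
        mm_comp A' (da_delta M) (da_delta M) x as + mm_diff_in A (da_delta M) x as
          + mm_mult_in A (da_delta M) x as + mm_diff_out A' (da_delta M) x as = 0) \<and>
     \<comment> \<open>strict unitality\<close>
     (\<forall>x\<in>da_gens M. da_delta M x [dg_id A (da_right M x)] = bas (dg_id A' (da_left M x), x)) \<and>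
     (\<forall>x\<in>da_gens M. \<forall>as T. dg_chain A (da_right M x) as T \<longrightarrow> length as > 1 \<longrightarrow>
        set as \<inter> range (dg_id A) \<noteq> {} \<longrightarrow> da_delta M x as = 0)"


section \<open>The dg category of DA bimodules\<close>

definition da_plus_input ::
  "('o, 'a) dgcat \<Rightarrow> ('p, 'o, 'c, 'a, 'm) da \<Rightarrow> 'm \<Rightarrow> 'a list \<Rightarrow> bool" where
  "da_plus_input A M x as \<longleftrightarrow>
     x \<in> da_gens M \<and> set as \<subseteq> dg_plus A \<and> (\<exists>T. dg_chain A (da_right M x) as T)"

text \<open>Morphisms of bidegree \<open>d\<close>.  They are defined on \<open>M \<otimes> A\<^sub>+[1] \<otimes> \<dots> \<otimes> A\<^sub>+[1]\<close> only; the
  underlying function takes the value 0 elsewhere, so that equality is equality of functions.\<close>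
definition da_morphism ::
  "('p, 'c) dgcat \<Rightarrow> ('o, 'a) dgcat \<Rightarrow> ('p, 'o, 'c, 'a, 'm) da \<Rightarrow> ('p, 'o, 'c, 'a, 'n) da
     \<Rightarrow> bideg \<Rightarrow> ('m, 'a, 'c, 'n) multi_map \<Rightarrow> bool" where
  "da_morphism A' A M N d f \<longleftrightarrow>
     (\<forall>x as. \<not> da_plus_input A M x as \<longrightarrow> f x as = 0) \<and>
     (\<forall>x as T. da_plus_input A M x as \<longrightarrow> dg_chain A (da_right M x) as T \<longrightarrow>
        (\<forall>(c, y)\<in>Poly_Mapping.keys (f x as).
           y \<in> da_gens N \<and> c \<in> dg_hom A' (da_left M x) (da_left N y) \<and> da_right N y = T \<and>
           da_deg M x + dg_shifted_deg A as + d = dg_deg A' c + da_deg N y))"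

definition da_mor_diff ::
  "('p, 'c) dgcat \<Rightarrow> ('o, 'a) dgcat \<Rightarrow> ('p, 'o, 'c, 'a, 'm) da \<Rightarrow> ('p, 'o, 'c, 'a, 'n) da
     \<Rightarrow> ('m, 'a, 'c, 'n) multi_map \<Rightarrow> ('m, 'a, 'c, 'n) multi_map" where
  "da_mor_diff A' A M N f x as =
     (if da_plus_input A M x as
      then mm_comp A' (da_delta N) f x as + mm_comp A' f (da_delta M) x as
             + mm_diff_in A f x as + mm_mult_in A f x as + mm_diff_out A' f x as
      else 0)"

definition da_mor_id ::
  "('p, 'c) dgcat \<Rightarrow> ('p, 'o, 'c, 'a, 'm) da \<Rightarrow> ('m, 'a, 'c, 'm) multi_map" where
  "da_mor_id A' M x as =
     (if x \<in> da_gens M \<and> as = [] then bas (dg_id A' (da_left M x), x) else 0)"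

definition da_homotopy_equiv ::
  "('p, 'c) dgcat \<Rightarrow> ('o, 'a) dgcat \<Rightarrow> ('p, 'o, 'c, 'a, 'm) da \<Rightarrow> ('p, 'o, 'c, 'a, 'n) da
     \<Rightarrow> bool" where
  "da_homotopy_equiv A' A M N \<longleftrightarrow>
     da_bimodule A' A M \<and> da_bimodule A' A N \<and>
     (\<exists>f g h k.
        da_morphism A' A M N (0, 0) f \<and> da_mor_diff A' A M N f = (\<lambda>_ _. 0) \<and>
        da_morphism A' A N M (0, 0) g \<and> da_mor_diff A' A N M g = (\<lambda>_ _. 0) \<and>
        da_morphism A' A M M (0, - 1) h \<and> da_morphism A' A N N (0, - 1) k \<and>
        (\<forall>x as. mm_comp A' g f x as - da_mor_id A' M x as = da_mor_diff A' A M M h x as) \<and>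
        (\<forall>y as. mm_comp A' f g y as - da_mor_id A' N y as = da_mor_diff A' A N N k y as))"


section \<open>Box products and the identity bimodule\<close>

text \<open>\<open>da_iter N j\<close> is the \<open>j\<close>-fold iterate of the structure map; its \<open>j\<close> algebra outputs are
  listed in order.\<close>
primrec da_iter ::
  "('p, 'o, 'c, 'a, 'n) da \<Rightarrow> nat \<Rightarrow> 'n \<Rightarrow> 'a list \<Rightarrow> ('c list \<times> 'n) f2" where
  "da_iter N 0 y as = (if as = [] then bas ([], y) else 0)"
| "da_iter N (Suc j) y as =
     (\<Sum>p\<le>length as.
        lin (\<lambda>(b, y'). lin (\<lambda>(bs, y''). bas (b # bs, y'')) (da_iter N j y' (drop p as)))
          (da_delta N y (take p as)))"

definition box_term ::
  "('p, 'o, 'c, 'b, 'm) da \<Rightarrow> ('o, 'r, 'b, 'a, 'n) da \<Rightarrow> nat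
     \<Rightarrow> ('m \<times> 'n, 'a, 'c, 'm \<times> 'n) multi_map" where
  "box_term M N j z as =
     lin (\<lambda>(bs, y'). lin (\<lambda>(c, x'). bas (c, (x', y'))) (da_delta M (fst z) bs))
       (da_iter N j (snd z) as)"

text \<open>\<open>Sum_any\<close> is 0 if infinitely many terms are nonzero; \<open>box_defined\<close> excludes this.\<close>
definition box_prod ::
  "('p, 'o, 'c, 'b, 'm) da \<Rightarrow> ('o, 'r, 'b, 'a, 'n) da \<Rightarrow> ('p, 'r, 'c, 'a, 'm \<times> 'n) da"
  (infixr "\<boxtimes>" 70) where
  "M \<boxtimes> N =
     \<lparr> da_gens = {(x, y). x \<in> da_gens M \<and> y \<in> da_gens N \<and> da_right M x = da_left N y},
       da_left = (\<lambda>(x, y). da_left M x),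
       da_right = (\<lambda>(x, y). da_right N y),
       da_deg = (\<lambda>(x, y). da_deg M x + da_deg N y),
       da_delta = (\<lambda>z as. Sum_any (\<lambda>j. box_term M N j z as)) \<rparr>"

definition box_defined ::
  "('r, 'a) dgcat \<Rightarrow> ('p, 'o, 'c, 'b, 'm) da \<Rightarrow> ('o, 'r, 'b, 'a, 'n) da \<Rightarrow> bool" where
  "box_defined A M N \<longleftrightarrow>
     (\<forall>z\<in>da_gens (M \<boxtimes> N). \<forall>as T. dg_chain A (da_right (M \<boxtimes> N) z) as T \<longrightarrow>
        finite {j. box_term M N j z as \<noteq> 0})"

definition da_identity :: "('o, 'a) dgcat \<Rightarrow> ('o, 'o, 'a, 'a, 'o) da" where
  "da_identity A =
     \<lparr> da_gens = UNIV, da_left = id, da_right = id, da_deg = (\<lambda>_. (0, 0)),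
       da_delta = (\<lambda>T as. case as of
           [a] \<Rightarrow> if a \<in> dg_basis A \<and> dg_tgt A a = T then bas (a, dg_src A a) else 0
         | _ \<Rightarrow> 0) \<rparr>"

text \<open>The strictly unital bimodule with prescribed operations on non-identity inputs.\<close>
definition strictly_unital_delta ::
  "('p, 'c) dgcat \<Rightarrow> ('o, 'a) dgcat \<Rightarrow> ('m \<Rightarrow> 'p) \<Rightarrow> ('m \<Rightarrow> 'o)
     \<Rightarrow> ('m, 'a, 'c, 'm) multi_map \<Rightarrow> ('m, 'a, 'c, 'm) multi_map" where
  "strictly_unital_delta A' A l r ops x as =
     (if as = [dg_id A (r x)] then bas (dg_id A' (l x), x)
      else if set as \<inter> range (dg_id A) \<noteq> {} then 0
      else ops x as)"


section \<open>Left duals and decategorification\<close>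

text \<open>AD bimodules: \<open>ad_delta N [a\<^sub>1, \<dots>, a\<^sub>n] x\<close> is the operation applied to
  \<open>a\<^sub>1 \<otimes> \<dots> \<otimes> a\<^sub>n \<otimes> x\<close>, and \<open>(x', c)\<close> stands for \<open>x' \<otimes> c\<close>.\<close>
record ('p, 'o, 'c, 'a, 'm) ad =
  ad_gens :: "'m set"
  ad_left :: "'m \<Rightarrow> 'p"
  ad_right :: "'m \<Rightarrow> 'o"
  ad_deg :: "'m \<Rightarrow> bideg"
  ad_delta :: "'a list \<Rightarrow> 'm \<Rightarrow> ('m \<times> 'c) f2"

text \<open>The dual basis of a finite basis is indexed by the basis itself.\<close>
definition left_dual :: "('p, 'o, 'c, 'a, 'm) da \<Rightarrow> ('o, 'p, 'c, 'a, 'm) ad" where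
  "left_dual M =
     \<lparr> ad_gens = da_gens M, ad_left = da_right M, ad_right = da_left M,
       ad_deg = (\<lambda>x. - da_deg M x),
       ad_delta = (\<lambda>as y. \<Sum>x\<in>da_gens M.
          lin (\<lambda>(c, y'). if y' = y then bas (x, c) else 0) (da_delta M x as)) \<rparr>"

type_synonym Cq = "complex poly fract"  \<comment> \<open>the field \<open>\<complex>(q)\<close>\<close>

definition qv :: Cq where
  "qv = Fraction_Field.Fract [:0, 1:] 1"

text \<open>\<open>G\<^sub>0(A)\<close> is \<open>Cq ^ 'o\<close> for a category with finite set of objects \<open>'o\<close>;
  the basis vector \<open>[S\<^sub>s]\<close> is \<open>axis s 1\<close>.\<close>
definition G0_map :: "('p::finite, 'o::finite, 'c, 'a, 'm) ad \<Rightarrow> Cq ^ 'o \<Rightarrow> Cq ^ 'p" where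
  "G0_map N v = (\<chi> s'. \<Sum>s\<in>UNIV.
     (\<Sum>x | x \<in> ad_gens N \<and> ad_left N x = s' \<and> ad_right N x = s.
        (- 1) powi snd (ad_deg N x) * qv powi fst (ad_deg N x)) * v $ s)"


section \<open>The two algebras\<close>

datatype std_obj = S_uu | S_ou | S_uo | S_oo
datatype can_obj = S_empty | S_A | S_B | S_AB

lemma UNIV_std_obj: "UNIV = {S_uu, S_ou, S_uo, S_oo}"
  by (auto intro: std_obj.exhaust)

lemma UNIV_can_obj: "UNIV = {S_empty, S_A, S_B, S_AB}"
  by (auto intro: can_obj.exhaust)

instance std_obj :: finite
  by standard (simp add: UNIV_std_obj)

instance can_obj :: finite
  by standard (simp add: UNIV_can_obj)

datatype std_mor =
    Id_uu
  | U1_ou nat          \<comment> \<open>\<open>U\<^sub>1^k\<close> at ou\<close>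
  | U2_uo nat          \<comment> \<open>\<open>U\<^sub>2^k\<close> at uo\<close>
  | U12_oo nat nat     \<comment> \<open>\<open>U\<^sub>1^k U\<^sub>2^l\<close> at oo\<close>
  | Lam                \<comment> \<open>\<open>\<lambda>\<close>\<close>

primrec std_tgt :: "std_mor \<Rightarrow> std_obj" where
  "std_tgt Id_uu = S_uu"
| "std_tgt (U1_ou k) = S_ou"
| "std_tgt (U2_uo k) = S_uo"
| "std_tgt (U12_oo k l) = S_oo"
| "std_tgt Lam = S_uo"

primrec std_src :: "std_mor \<Rightarrow> std_obj" where
  "std_src Id_uu = S_uu"
| "std_src (U1_ou k) = S_ou"
| "std_src (U2_uo k) = S_uo"
| "std_src (U12_oo k l) = S_oo"
| "std_src Lam = S_ou"

primrec std_deg :: "std_mor \<Rightarrow> bideg" where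
  "std_deg Id_uu = (0, 0)"
| "std_deg (U1_ou k) = (- 2 * int k, 2 * int k)"
| "std_deg (U2_uo k) = (- 2 * int k, 2 * int k)"
| "std_deg (U12_oo k l) = (- 2 * int (k + l), 2 * int (k + l))"
| "std_deg Lam = (1, 0)"

primrec std_id :: "std_obj \<Rightarrow> std_mor" where
  "std_id S_uu = Id_uu"
| "std_id S_ou = U1_ou 0"
| "std_id S_uo = U2_uo 0"
| "std_id S_oo = U12_oo 0 0"

fun std_mult :: "std_mor \<Rightarrow> std_mor \<Rightarrow> std_mor f2" where
  "std_mult Id_uu Id_uu = bas Id_uu"
| "std_mult (U1_ou k) (U1_ou l) = bas (U1_ou (k + l))"
| "std_mult (U2_uo k) (U2_uo l) = bas (U2_uo (k + l))"
| "std_mult (U12_oo k l) (U12_oo k' l') = bas (U12_oo (k + k') (l + l'))"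
| "std_mult Lam (U1_ou k) = (if k = 0 then bas Lam else 0)"
| "std_mult (U2_uo k) Lam = (if k = 0 then bas Lam else 0)"
| "std_mult _ _ = 0"

definition A11 :: "(std_obj, std_mor) dgcat" where
  "A11 = \<lparr> dg_basis = UNIV, dg_tgt = std_tgt, dg_src = std_src, dg_deg = std_deg,
           dg_id = std_id, dg_mult = std_mult, dg_diff = (\<lambda>_. 0) \<rparr>"

datatype can_mor =
    Id_empty
  | U1_A nat           \<comment> \<open>\<open>U\<^sub>1^k\<close> at A\<close>
  | U1_B nat           \<comment> \<open>\<open>U\<^sub>1^k\<close> at B, including the identity for \<open>k = 0\<close>\<close>
  | U2_B nat           \<comment> \<open>\<open>U\<^sub>2^(k+1)\<close> at B; note the shift\<close>
  | R1U1 nat           \<comment> \<open>\<open>R\<^sub>1 U\<^sub>1^k\<close>\<close>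
  | L1U1 nat           \<comment> \<open>\<open>L\<^sub>1 U\<^sub>1^k\<close>\<close>
  | U12_AB nat nat     \<comment> \<open>\<open>U\<^sub>1^k U\<^sub>2^l\<close> at AB\<close>

primrec can_tgt :: "can_mor \<Rightarrow> can_obj" where
  "can_tgt Id_empty = S_empty"
| "can_tgt (U1_A k) = S_A"
| "can_tgt (U1_B k) = S_B"
| "can_tgt (U2_B k) = S_B"
| "can_tgt (R1U1 k) = S_A"
| "can_tgt (L1U1 k) = S_B"
| "can_tgt (U12_AB k l) = S_AB"

primrec can_src :: "can_mor \<Rightarrow> can_obj" where
  "can_src Id_empty = S_empty"
| "can_src (U1_A k) = S_A"
| "can_src (U1_B k) = S_B"
| "can_src (U2_B k) = S_B"
| "can_src (R1U1 k) = S_B"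
| "can_src (L1U1 k) = S_A"
| "can_src (U12_AB k l) = S_AB"

primrec can_deg :: "can_mor \<Rightarrow> bideg" where
  "can_deg Id_empty = (0, 0)"
| "can_deg (U1_A k) = (- 2 * int k, 2 * int k)"
| "can_deg (U1_B k) = (- 2 * int k, 2 * int k)"
| "can_deg (U2_B k) = (- 2 * int (k + 1), 2 * int (k + 1))"
| "can_deg (R1U1 k) = (- 1 - 2 * int k, 1 + 2 * int k)"
| "can_deg (L1U1 k) = (- 1 - 2 * int k, 1 + 2 * int k)"
| "can_deg (U12_AB k l) = (- 2 * int (k + l), 2 * int (k + l))"

primrec can_id :: "can_obj \<Rightarrow> can_mor" where
  "can_id S_empty = Id_empty"
| "can_id S_A = U1_A 0"
| "can_id S_B = U1_B 0"
| "can_id S_AB = U12_AB 0 0"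

text \<open>Multiplication table of the path algebra modulo \<open>R\<^sub>1 U\<^sub>2 = 0 = U\<^sub>2 L\<^sub>1\<close>, where
  \<open>U\<^sub>1 = R\<^sub>1 L\<^sub>1\<close> at A and \<open>U\<^sub>1 = L\<^sub>1 R\<^sub>1\<close> at B.  Hence \<open>U\<^sub>1 R\<^sub>1 = R\<^sub>1 U\<^sub>1\<close>,
  \<open>U\<^sub>1 L\<^sub>1 = L\<^sub>1 U\<^sub>1\<close>, and \<open>U\<^sub>1 U\<^sub>2 = 0 = U\<^sub>2 U\<^sub>1\<close> at B.\<close>
fun can_mult :: "can_mor \<Rightarrow> can_mor \<Rightarrow> can_mor f2" where
  "can_mult Id_empty Id_empty = bas Id_empty"
| "can_mult (U1_A k) (U1_A l) = bas (U1_A (k + l))"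
| "can_mult (U1_A k) (R1U1 l) = bas (R1U1 (k + l))"
| "can_mult (R1U1 k) (U1_B l) = bas (R1U1 (k + l))"
| "can_mult (R1U1 k) (L1U1 l) = bas (U1_A (k + l + 1))"
| "can_mult (L1U1 k) (U1_A l) = bas (L1U1 (k + l))"
| "can_mult (L1U1 k) (R1U1 l) = bas (U1_B (k + l + 1))"
| "can_mult (U1_B k) (L1U1 l) = bas (L1U1 (k + l))"
| "can_mult (U1_B k) (U1_B l) = bas (U1_B (k + l))"
| "can_mult (U1_B k) (U2_B l) = (if k = 0 then bas (U2_B l) else 0)"
| "can_mult (U2_B k) (U1_B l) = (if l = 0 then bas (U2_B k) else 0)"
| "can_mult (U2_B k) (U2_B l) = bas (U2_B (k + l + 1))"
| "can_mult (U12_AB k l) (U12_AB k' l') = bas (U12_AB (k + k') (l + l'))"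
| "can_mult _ _ = 0"

definition A11can :: "(can_obj, can_mor) dgcat" where
  "A11can = \<lparr> dg_basis = UNIV, dg_tgt = can_tgt, dg_src = can_src, dg_deg = can_deg,
              dg_id = can_id, dg_mult = can_mult, dg_diff = (\<lambda>_. 0) \<rparr>"

lemma lin_bas [simp]: "lin f (bas x) = f x"
  by (simp add: lin_def bas_def)

lemma lin_zero [simp]: "lin f 0 = 0" "lin (\<lambda>_. 0) v = 0"
  by (simp_all add: lin_def)

lemma keys_bas [simp]: "Poly_Mapping.keys (bas x) = {x}"
  by (simp add: bas_def)

lemma dg_category_A11: "dg_category A11"
proof -
  have ids: "range std_id = {Id_uu, U1_ou 0, U2_uo 0, U12_oo 0 0}"
    by (simp add: UNIV_std_obj)
  have assoc: "lin (\<lambda>x. std_mult x c) (std_mult a b) = lin (std_mult a) (std_mult b c)" for a b c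
    by (cases a; cases b; cases c) (auto simp: add.assoc)
  have id1: "std_tgt (std_id S) = S \<and> std_src (std_id S) = S \<and> std_deg (std_id S) = (0, 0)" for S
    by (cases S) auto
  have unit: "std_mult (std_id (std_tgt a)) a = bas a \<and> std_mult a (std_id (std_src a)) = bas a" for a
    by (cases a) auto
  have graded: "std_tgt c = std_tgt a \<and> std_src c = std_src b \<and> std_deg c = std_deg a + std_deg b"
    if "c \<in> Poly_Mapping.keys (std_mult a b)" for a b c
    using that by (cases a; cases b) (auto split: if_splits)
  have aug: "a \<notin> range std_id \<or> b \<notin> range std_id \<Longrightarrow>
      Poly_Mapping.keys (std_mult a b) \<inter> range std_id = {}" for a b
    unfolding ids by (cases a; cases b) auto
  show ?thesis
    using assoc id1 unit graded aug
    by (simp add: dg_category_def A11_def dg_hom_def dg_plus_def) blast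
qed

lemma dg_category_A11can: "dg_category A11can"
proof -
  have ids: "range can_id = {Id_empty, U1_A 0, U1_B 0, U12_AB 0 0}"
    by (simp add: UNIV_can_obj)
  have assoc: "lin (\<lambda>x. can_mult x c) (can_mult a b) = lin (can_mult a) (can_mult b c)" for a b c
    by (cases a; cases b; cases c) (auto simp: add.assoc)
  have id1: "can_tgt (can_id S) = S \<and> can_src (can_id S) = S \<and> can_deg (can_id S) = (0, 0)" for S
    by (cases S) auto
  have unit: "can_mult (can_id (can_tgt a)) a = bas a \<and> can_mult a (can_id (can_src a)) = bas a" for a
    by (cases a) auto
  have graded: "can_tgt c = can_tgt a \<and> can_src c = can_src b \<and> can_deg c = can_deg a + can_deg b"
    if "c \<in> Poly_Mapping.keys (can_mult a b)" for a b c
    using that by (cases a; cases b) (auto split: if_splits)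
  have aug: "a \<notin> range can_id \<or> b \<notin> range can_id \<Longrightarrow>
      Poly_Mapping.keys (can_mult a b) \<inter> range can_id = {}" for a b
    unfolding ids by (cases a; cases b) auto
  show ?thesis
    using assoc id1 unit graded aug
    by (simp add: dg_category_def A11can_def dg_hom_def dg_plus_def) blast
qed


section \<open>The change-of-basis bimodules\<close>

datatype K_gen = kap1 | kap2 | kap3 | kap4 | kap5

primrec K_left :: "K_gen \<Rightarrow> can_obj" where
  "K_left kap1 = S_empty" | "K_left kap2 = S_A" | "K_left kap3 = S_A"
| "K_left kap4 = S_B" | "K_left kap5 = S_AB"

primrec K_right :: "K_gen \<Rightarrow> std_obj" where
  "K_right kap1 = S_uu" | "K_right kap2 = S_ou" | "K_right kap3 = S_uo"
| "K_right kap4 = S_uo" | "K_right kap5 = S_oo"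

definition K_ops :: "(K_gen, std_mor, can_mor, K_gen) multi_map" where
  "K_ops x as = (case (x, as) of
       (kap2, [U1_ou (Suc k)]) \<Rightarrow> bas (U1_A (k + 1), kap2)
     | (kap3, []) \<Rightarrow> bas (R1U1 0, kap4)
     | (kap3, [Lam]) \<Rightarrow> bas (can_id S_A, kap2)
     | (kap4, [U2_uo (Suc k)]) \<Rightarrow> bas (U2_B k, kap4)
     | (kap4, [Lam, U1_ou (Suc k)]) \<Rightarrow> bas (L1U1 k, kap2)
     | (kap5, [U12_oo k l]) \<Rightarrow> bas (U12_AB k l, kap5)
     | _ \<Rightarrow> 0)"

definition KK :: "(can_obj, std_obj, can_mor, std_mor, K_gen) da" where
  "KK = \<lparr> da_gens = UNIV, da_left = K_left, da_right = K_right,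
          da_deg = (\<lambda>x. if x = kap3 then (- 1, 0) else (0, 0)),
          da_delta = strictly_unital_delta A11can A11 K_left K_right K_ops \<rparr>"

datatype L_gen = lam1 | lam2 | lam3 | lam4 | lam5

primrec L_left :: "L_gen \<Rightarrow> std_obj" where
  "L_left lam1 = S_uu" | "L_left lam2 = S_ou" | "L_left lam3 = S_ou"
| "L_left lam4 = S_uo" | "L_left lam5 = S_oo"

primrec L_right :: "L_gen \<Rightarrow> can_obj" where
  "L_right lam1 = S_empty" | "L_right lam2 = S_A" | "L_right lam3 = S_B"
| "L_right lam4 = S_B" | "L_right lam5 = S_AB"

definition L_ops :: "(L_gen, can_mor, std_mor, L_gen) multi_map" where
  "L_ops x as = (case (x, as) of
       (lam2, [U1_A (Suc k)]) \<Rightarrow> bas (U1_ou (k + 1), lam2)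
     | (lam2, [R1U1 k]) \<Rightarrow> bas (U1_ou k, lam3)
     | (lam3, [L1U1 k]) \<Rightarrow> bas (U1_ou (k + 1), lam2)
     | (lam3, [U1_B (Suc k)]) \<Rightarrow> bas (U1_ou (k + 1), lam3)
     | (lam4, []) \<Rightarrow> bas (Lam, lam3)
     | (lam4, [U2_B k]) \<Rightarrow> bas (U2_uo (k + 1), lam4)
     | (lam5, [U12_AB k l]) \<Rightarrow> bas (U12_oo k l, lam5)
     | _ \<Rightarrow> 0)"

definition LL :: "(std_obj, can_obj, std_mor, can_mor, L_gen) da" where
  "LL = \<lparr> da_gens = UNIV, da_left = L_left, da_right = L_right,
          da_deg = (\<lambda>x. if x = lam3 then (- 1, 1) else (0, 0)),
          da_delta = strictly_unital_delta A11 A11can L_left L_right L_ops \<rparr>"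


section \<open>Standard and canonical basis\<close>

text \<open>The exterior algebra on generators indexed by a finite linearly ordered type: coordinate
  \<open>I\<close> refers to the product of the generators in \<open>I\<close> in increasing order.\<close>

definition wedge :: "Cq ^ ('i::{finite, linorder} set) \<Rightarrow> Cq ^ ('i set) \<Rightarrow> Cq ^ ('i set)" where
  "wedge x y = (\<chi> I. \<Sum>J\<in>Pow I.
     (- 1) ^ card {(j, k). j \<in> J \<and> k \<in> I - J \<and> k < j} * x $ J * y $ (I - J))"

definition ext_gen :: "'i::{finite, linorder} \<Rightarrow> Cq ^ ('i set)" where
  "ext_gen i = axis {i} 1"

definition ext_one :: "Cq ^ ('i::{finite, linorder} set)" where
  "ext_one = axis {} 1"

datatype ix = Ix1 | Ix2

lemma UNIV_ix: "UNIV = {Ix1, Ix2}"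
  by (auto intro: ix.exhaust)

instance ix :: finite
  by standard (simp add: UNIV_ix)

instantiation ix :: linorder
begin

definition less_eq_ix :: "ix \<Rightarrow> ix \<Rightarrow> bool" where "x \<le> y \<longleftrightarrow> x = Ix1 \<or> y = Ix2"
definition less_ix :: "ix \<Rightarrow> ix \<Rightarrow> bool" where "x < y \<longleftrightarrow> x = Ix1 \<and> y = Ix2"

instance
  by standard (auto simp: less_eq_ix_def less_ix_def intro: ix.exhaust)

end

definition ext_e1 :: "Cq ^ (ix set)" where "ext_e1 = ext_gen Ix1"
definition ext_e2 :: "Cq ^ (ix set)" where "ext_e2 = ext_gen Ix2"

text \<open>\<open>V\<close> is \<open>Cq ^ bit\<close>, with \<open>V \<otimes> V\<close> realised on pairs of indices;
  \<open>V2_to_ext\<close> is the identification with the exterior algebra.\<close>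

instance bit :: finite
proof
  have "(UNIV :: bit set) = {0, 1}" by auto
  then show "finite (UNIV :: bit set)" by (metis finite.emptyI finite.insertI)
qed

definition tensor :: "Cq ^ bit \<Rightarrow> Cq ^ bit \<Rightarrow> Cq ^ (bit \<times> bit)" where
  "tensor v w = (\<chi> p. v $ fst p * w $ snd p)"

definition ket :: "bit \<Rightarrow> bit \<Rightarrow> Cq ^ (bit \<times> bit)" where
  "ket i j = tensor (axis i 1) (axis j 1)"

definition V2_to_ext :: "Cq ^ (bit \<times> bit) \<Rightarrow> Cq ^ (ix set)" where
  "V2_to_ext x = x $ (0, 0) *s wedge ext_e2 ext_e1 + x $ (1, 0) *s ext_e2 + x $ (0, 1) *s ext_e1
                   + x $ (1, 1) *s ext_one"

definition can_l1 :: "Cq ^ (ix set)" where "can_l1 = ext_e1"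
definition can_l2 :: "Cq ^ (ix set)" where "can_l2 = qv *s ext_e1 + ext_e2"

primrec standard_basis :: "std_obj \<Rightarrow> Cq ^ (ix set)" where
  "standard_basis S_uu = V2_to_ext (ket 0 0)"
| "standard_basis S_ou = V2_to_ext (ket 1 0)"
| "standard_basis S_uo = V2_to_ext (ket 0 1)"
| "standard_basis S_oo = V2_to_ext (ket 1 1)"

primrec canonical_basis :: "can_obj \<Rightarrow> Cq ^ (ix set)" where
  "canonical_basis S_empty = wedge can_l2 can_l1"
| "canonical_basis S_A = can_l2"
| "canonical_basis S_B = can_l1"
| "canonical_basis S_AB = ext_one"

definition is_basis :: "('s \<Rightarrow> Cq ^ 'n) \<Rightarrow> bool" where
  "is_basis b \<longleftrightarrow> inj b \<and> vec.independent (range b) \<and> vec.span (range b) = UNIV"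

text \<open>Column \<open>s\<close> of the matrix from \<open>b\<close> to \<open>b'\<close> lists the coordinates of \<open>b s\<close> in
  the basis \<open>b'\<close>.\<close>
definition change_of_basis_matrix ::
  "('s::finite \<Rightarrow> Cq ^ 'n) \<Rightarrow> ('t::finite \<Rightarrow> Cq ^ 'n) \<Rightarrow> Cq ^ 's ^ 't \<Rightarrow> bool" where
  "change_of_basis_matrix b b' P \<longleftrightarrow>
     is_basis b \<and> is_basis b' \<and> (\<forall>s. b s = (\<Sum>t\<in>UNIV. P $ t $ s *s b' t))"

text \<open>Positions of the objects in the orderings (uu, ou, uo, oo) and (empty, A, B, AB).\<close>
primrec std_pos :: "std_obj \<Rightarrow> nat" where
  "std_pos S_uu = 0" | "std_pos S_ou = 1" | "std_pos S_uo = 2" | "std_pos S_oo = 3"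

primrec can_pos :: "can_obj \<Rightarrow> nat" where
  "can_pos S_empty = 0" | "can_pos S_A = 1" | "can_pos S_B = 2" | "can_pos S_AB = 3"

end

theory Submission
  imports Defs
begin

text \<open>All operations involved have at most two algebra inputs, and the algebras have no
  differential.  Hence every structure relation and every morphism equation holds trivially on
  long inputs, and for the remaining ones it is a finite check on composable strings
  (\<open>da_bimodule_boundedI\<close>, \<open>da_homotopy_equiv_retractI\<close>); the exponents of the \<open>U\<^sub>i\<close> remain
  symbolic.  For the same reason the sums defining the two box products are finite, and the box
  products can be computed in closed form (\<open>KL_delta\<close>, \<open>LK_delta\<close>).

  Each box product has six generators, two more than the identity bimodule.  In
  \<open>KK \<boxtimes> LL\<close> the differential of \<open>(kap3, lam4)\<close> contains \<open>(kap2, lam3)\<close> with coefficient an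
  identity, and in \<open>LL \<boxtimes> KK\<close> the differential of \<open>(lam2, kap3)\<close> is \<open>(lam3, kap4)\<close> with
  coefficient an identity.  Cancelling this pair by homological perturbation leaves exactly the
  identity bimodule.  The perturbation series stop after the first order, and they give an
  explicit deformation retraction in each case (\<open>KL_homotopy_equiv\<close>, \<open>LK_homotopy_equiv\<close>).

  The entries of the matrices of the left duals are the signed graded counts of the generators
  between two objects.  The only generators off the diagonal are \<open>kap3\<close> and \<open>lam3\<close>, of
  bidegrees \<open>(-1, 0)\<close> and \<open>(-1, 1)\<close>; in the duals they contribute \<open>q\<close> and \<open>-q\<close>, which are the
  nontrivial coefficients in \<open>\<ell>\<^sub>2 = q e\<^sub>1 + e\<^sub>2\<close> and in \<open>e\<^sub>2 = \<ell>\<^sub>2 - q \<ell>\<^sub>1\<close>.\<close>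


section \<open>Linear algebra over the field with two elements\<close>

lemma f2_add_self [simp]: "v + v = (0 :: 'b f2)"
  by (rule poly_mapping_eqI) (simp add: lookup_add)

lemma f2_add_self_left [simp]: "v + (v + w) = (w :: 'b f2)"
  by (simp flip: add.assoc)

lemma f2_diff [simp]: "v - w = (v + w :: 'b f2)"
  by (simp add: diff_eq_eq add.assoc)

lemma lin_add [simp]: "lin f (v + w) = lin f v + lin f w"
proof -
  let ?K = "Poly_Mapping.keys"
  have keys: "?K (v + w) = (?K v - ?K w) \<union> (?K w - ?K v)"
    by (auto simp: in_keys_iff lookup_add)
  have "lin f (v + w) = sum f (?K v - ?K w) + sum f (?K w - ?K v)"
    unfolding lin_def keys by (rule sum.union_disjoint) auto
  moreover have "sum f (?K v) = sum f (?K v - ?K w) + sum f (?K v \<inter> ?K w)"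
    by (subst sum.union_disjoint [symmetric]) (auto intro!: arg_cong2 [where f = sum])
  moreover have "sum f (?K w) = sum f (?K w - ?K v) + sum f (?K v \<inter> ?K w)"
    by (subst sum.union_disjoint [symmetric]) (auto intro!: arg_cong2 [where f = sum])
  ultimately show ?thesis
    by (simp add: lin_def ac_simps)
qed

lemma lin_cong: "(\<And>x. x \<in> Poly_Mapping.keys v \<Longrightarrow> f x = g x) \<Longrightarrow> lin f v = lin g v"
  by (simp add: lin_def)

lemma lin_eq_0I: "(\<And>x. x \<in> Poly_Mapping.keys v \<Longrightarrow> f x = 0) \<Longrightarrow> lin f v = 0"
  by (simp add: lin_def)

lemma keys_bas_add_bas [simp]:
  "Poly_Mapping.keys (bas x + bas y) = (if x = y then {} else {x, y})"
  by (auto simp: in_keys_iff lookup_add bas_def lookup_single when_def split: if_splits)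

lemma keys_sumE:
  assumes "z \<in> Poly_Mapping.keys (sum f A)"
  obtains x where "x \<in> A" "z \<in> Poly_Mapping.keys (f x)"
  using assms keys_sum [of f A] by blast

lemma keys_linE:
  assumes "z \<in> Poly_Mapping.keys (lin f v)"
  obtains x where "x \<in> Poly_Mapping.keys v" "z \<in> Poly_Mapping.keys (f x)"
  using assms keys_sum [of f "Poly_Mapping.keys v"] unfolding lin_def by blast


section \<open>Operations of bounded arity\<close>

lemma list_cases_upto_2:
  obtains "as = []" | a where "as = [a]" | a b where "as = [a, b]"
    | a b c cs where "as = a # b # c # cs"
  by (metis neq_Nil_conv)

lemma list_cases_upto_4:
  obtains "as = []" | a where "as = [a]" | a b where "as = [a, b]" | a b c where "as = [a, b, c]"
    | a b c d where "as = [a, b, c, d]" | "4 < length as"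
proof (cases as rule: list_cases_upto_2)
  case (4 a b c cs)
  then show thesis
    using that(4-6) by (cases cs rule: list_cases_upto_2) auto
qed (use that in auto)

text \<open>All operations of \<open>f\<close> with more than \<open>n\<close> algebra inputs vanish.\<close>
definition mm_arity_le :: "nat \<Rightarrow> ('m, 'a, 'c, 'n) multi_map \<Rightarrow> bool" where
  "mm_arity_le n f \<longleftrightarrow> (\<forall>x as. n < length as \<longrightarrow> f x as = 0)"

lemma mm_arityD: "mm_arity_le n f \<Longrightarrow> n < length as \<Longrightarrow> f x as = 0"
  unfolding mm_arity_le_def by blast

lemma mm_arity_mono: "mm_arity_le m f \<Longrightarrow> m \<le> n \<Longrightarrow> mm_arity_le n f"
  by (simp add: mm_arity_le_def)

lemma mm_arity_add:
  "mm_arity_le n f \<Longrightarrow> mm_arity_le n g \<Longrightarrow> mm_arity_le n (\<lambda>x as. f x as + g x as)"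
  by (simp add: mm_arity_le_def)

lemma mm_comp_arity:
  assumes "mm_arity_le m f" "mm_arity_le n g"
  shows "mm_arity_le (m + n) (mm_comp A' g f)"
  unfolding mm_arity_le_def mm_comp_def
proof (intro allI impI sum.neutral ballI)
  fix x as p
  assume *: "m + n < length (as :: 'b list)" "p \<in> {..length as}"
  show "lin (\<lambda>(c, y). lin (\<lambda>(c', z). lin (\<lambda>b. bas (b, z)) (dg_mult A' c c')) (g y (drop p as)))
          (f x (take p as)) = 0"
  proof (cases "m < p")
    case True
    then show ?thesis using assms(1) * by (simp add: mm_arity_le_def)
  next
    case False
    then have "g y (drop p as) = 0" for y
      using assms(2) * by (simp add: mm_arity_le_def)
    then show ?thesis by (simp add: case_prod_unfold)
  qed
qed

lemma mm_mult_in_arity: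
  assumes "mm_arity_le n f"
  shows "mm_arity_le (Suc n) (mm_mult_in A f)"
  using assms unfolding mm_arity_le_def mm_mult_in_def
  by (auto intro!: sum.neutral lin_eq_0I)

lemma mm_diff_in_zero: "dg_diff A = (\<lambda>_. 0) \<Longrightarrow> mm_diff_in A f x as = 0"
  by (simp add: mm_diff_in_def)

lemma mm_diff_out_zero: "dg_diff A' = (\<lambda>_. 0) \<Longrightarrow> mm_diff_out A' f x as = 0"
  by (simp add: mm_diff_out_def case_prod_unfold)

text \<open>If the operations have at most \<open>n\<close> inputs and the algebras have no differential, both
  remaining terms of the structure relation vanish on more than \<open>2 * n\<close> inputs.  Over
  \<open>\<F>\<^sub>2\<close> the relation says that the two terms agree.\<close>
lemma da_bimodule_boundedI:
  assumes cats: "dg_category A'" "dg_category A"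
    and diff: "dg_diff A' = (\<lambda>_. 0)" "dg_diff A = (\<lambda>_. 0)"
    and arity: "mm_arity_le n (da_delta M)" "0 < n"
    and graded: "\<And>x as T c y. x \<in> da_gens M \<Longrightarrow> dg_chain A (da_right M x) as T \<Longrightarrow> length as \<le> n \<Longrightarrow>
        (c, y) \<in> Poly_Mapping.keys (da_delta M x as) \<Longrightarrow>
        y \<in> da_gens M \<and> c \<in> dg_hom A' (da_left M x) (da_left M y) \<and> da_right M y = T \<and>
        da_deg M x + dg_shifted_deg A as = dg_shifted_deg A' [c] + da_deg M y"
    and rel: "\<And>x as T. x \<in> da_gens M \<Longrightarrow> dg_chain A (da_right M x) as T \<Longrightarrow> length as \<le> 2 * n \<Longrightarrow>
        mm_comp A' (da_delta M) (da_delta M) x as = mm_mult_in A (da_delta M) x as"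
    and unit: "\<And>x. x \<in> da_gens M \<Longrightarrow>
        da_delta M x [dg_id A (da_right M x)] = bas (dg_id A' (da_left M x), x)"
    and unit0: "\<And>x as T. x \<in> da_gens M \<Longrightarrow> dg_chain A (da_right M x) as T \<Longrightarrow> 1 < length as \<Longrightarrow>
        length as \<le> n \<Longrightarrow> set as \<inter> range (dg_id A) \<noteq> {} \<Longrightarrow> da_delta M x as = 0"
  shows "da_bimodule A' A M"
proof -
  have rel': "mm_comp A' (da_delta M) (da_delta M) x as = mm_mult_in A (da_delta M) x as"
    if "x \<in> da_gens M" "dg_chain A (da_right M x) as T" for x as T
  proof (cases "length as \<le> 2 * n")
    case True
    with rel that show ?thesis by blast
  next
    case False
    then have "n + n < length as" "Suc n < length as"
      using \<open>0 < n\<close> by auto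
    then show ?thesis
      using mm_arityD [OF mm_comp_arity [OF arity(1) arity(1)]]
        mm_arityD [OF mm_mult_in_arity [OF arity(1)]] by metis
  qed
  have graded': "y \<in> da_gens M \<and> c \<in> dg_hom A' (da_left M x) (da_left M y) \<and> da_right M y = T \<and>
        da_deg M x + dg_shifted_deg A as = dg_shifted_deg A' [c] + da_deg M y"
    if "x \<in> da_gens M" "dg_chain A (da_right M x) as T"
      "(c, y) \<in> Poly_Mapping.keys (da_delta M x as)" for x as T c y
  proof (cases "length as \<le> n")
    case True
    with graded that show ?thesis by blast
  next
    case False
    with mm_arityD [OF arity(1), of as x] that(3) show ?thesis by simp
  qed
  have unit0': "da_delta M x as = 0"
    if "x \<in> da_gens M" "dg_chain A (da_right M x) as T" "1 < length as"
      "set as \<inter> range (dg_id A) \<noteq> {}" for x as T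
    using that unit0 mm_arityD [OF arity(1)] by (meson not_le)
  show ?thesis
    unfolding da_bimodule_def mm_diff_out_zero [OF diff(1)] mm_diff_in_zero [OF diff(2)]
    apply (intro conjI ballI allI impI cats unit)
    subgoal using graded' by blast
    subgoal using rel' by simp
    subgoal by assumption
    subgoal using unit0' by blast
    done
qed


section \<open>Box products with operations of bounded arity\<close>

lemma box_simps [simp]:
  "da_gens (M \<boxtimes> N) = {(x, y). x \<in> da_gens M \<and> y \<in> da_gens N \<and> da_right M x = da_left N y}"
  "da_left (M \<boxtimes> N) (x, y) = da_left M x"
  "da_right (M \<boxtimes> N) (x, y) = da_right N y"
  "da_deg (M \<boxtimes> N) (x, y) = da_deg M x + da_deg N y"
  by (simp_all add: box_prod_def)

lemma length_da_iter:
  "(bs, y') \<in> Poly_Mapping.keys (da_iter N j y as) \<Longrightarrow> length bs = j"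
proof (induction j arbitrary: bs y' y as)
  case 0
  then show ?case by (simp split: if_splits)
next
  case (Suc j)
  from Suc.prems obtain p where "(bs, y') \<in> Poly_Mapping.keys
      (lin (\<lambda>(b, y'). lin (\<lambda>(bs, y''). bas (b # bs, y'')) (da_iter N j y' (drop p as)))
          (da_delta N y (take p as)))"
    unfolding da_iter.simps by (rule keys_sumE)
  then obtain b y0 bs' where "(bs', y') \<in> Poly_Mapping.keys (da_iter N j y0 (drop p as))"
      "bs = b # bs'"
    by (auto elim!: keys_linE)
  with Suc.IH show ?case by auto
qed

text \<open>The \<open>j\<close>-th term of the box product feeds exactly \<open>j\<close> algebra elements into the left
  factor, so a bound on the arity there makes the defining sum finite.\<close>
lemma box_term_eq_0:
  assumes "mm_arity_le n (da_delta M)" "n < j"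
  shows "box_term M N j z as = 0"
  unfolding box_term_def
proof (rule lin_eq_0I, clarify)
  fix bs y'
  assume "(bs, y') \<in> Poly_Mapping.keys (da_iter N j (snd z) as)"
  then have "length bs = j"
    by (rule length_da_iter)
  then have "da_delta M (fst z) bs = 0"
    using assms by (simp add: mm_arity_le_def)
  then show "lin (\<lambda>(c, x'). bas (c, x', y')) (da_delta M (fst z) bs) = 0"
    by simp
qed

lemma box_term_nonzero:
  assumes "mm_arity_le n (da_delta M)" "box_term M N j z as \<noteq> 0"
  shows "j \<in> {..n}"
  using assms by (metis atMost_iff box_term_eq_0 not_le)

lemma box_defined_arity:
  assumes "mm_arity_le n (da_delta M)"
  shows "box_defined A M N"
  unfolding box_defined_def
proof (intro ballI allI impI)
  fix z as
  have "{j. box_term M N j z as \<noteq> 0} \<subseteq> {..n}"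
    by (intro subsetI box_term_nonzero [OF assms]) (elim CollectE)
  then show "finite {j. box_term M N j z as \<noteq> 0}"
    by (rule finite_subset) simp
qed

lemma box_delta_arity:
  assumes "mm_arity_le n (da_delta M)"
  shows "da_delta (M \<boxtimes> N) z as = (\<Sum>j\<le>n. box_term M N j z as)"
proof -
  have "{j. box_term M N j z as \<noteq> 0} \<subseteq> {..n}"
    by (intro subsetI box_term_nonzero [OF assms]) (elim CollectE)
  then show ?thesis
    by (simp add: box_prod_def Sum_any.expand_superset)
qed

lemma da_iter_arity:
  fixes N :: "('p, 'o, 'c, 'a, 'n) da"
  assumes "mm_arity_le n (da_delta N)"
  shows "mm_arity_le (j * n) (da_iter N j)"
proof (induction j)
  case 0
  then show ?case by (simp add: mm_arity_le_def)
next
  case (Suc j)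
  show ?case
    unfolding mm_arity_le_def da_iter.simps
  proof (intro allI impI sum.neutral ballI)
    fix x p and as :: "'a list"
    assume *: "Suc j * n < length as" "p \<in> {..length as}"
    show "lin (\<lambda>(b, y'). lin (\<lambda>(bs, y''). bas (b # bs, y'')) (da_iter N j y' (drop p as)))
          (da_delta N x (take p as)) = 0"
    proof (cases "n < p")
      case True
      then show ?thesis using assms * by (simp add: mm_arity_le_def)
    next
      case False
      then have "da_iter N j y (drop p as) = 0" for y
        using Suc * by (simp add: mm_arity_le_def)
      then show ?thesis by (simp add: case_prod_unfold)
    qed
  qed
qed

lemma box_prod_arity:
  fixes N :: "('o, 'r, 'b, 'a, 'n) da"
  assumes "mm_arity_le m (da_delta M)" "mm_arity_le n (da_delta N)"
  shows "mm_arity_le (m * n) (da_delta (M \<boxtimes> N))"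
  unfolding mm_arity_le_def box_delta_arity [OF assms(1)]
proof (intro allI impI sum.neutral ballI)
  fix z j and as :: "'a list"
  assume *: "m * n < length as" "j \<in> {..m}"
  then have "j * n < length as"
    by (metis atMost_iff le_less_trans mult_le_mono1)
  with da_iter_arity [OF assms(2)] show "box_term M N j z as = 0"
    by (simp add: mm_arity_le_def box_term_def)
qed


section \<open>The identity bimodule\<close>

lemma da_identity_simps [simp]:
  "da_gens (da_identity A) = UNIV" "da_left (da_identity A) = id"
  "da_right (da_identity A) = id" "da_deg (da_identity A) x = (0, 0)"
  "da_delta (da_identity A) T [] = 0"
  "da_delta (da_identity A) T [a] =
     (if a \<in> dg_basis A \<and> dg_tgt A a = T then bas (a, dg_src A a) else 0)"
  "da_delta (da_identity A) T (a # b # as) = 0"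
  by (simp_all add: da_identity_def)

lemma da_identity_arity: "mm_arity_le 1 (da_delta (da_identity A))"
  by (auto simp: mm_arity_le_def da_identity_def split: list.splits)

lemma da_bimodule_identity:
  assumes "dg_category A"
  shows "da_bimodule A A (da_identity A)"
proof -
  have keys_diff: "c \<in> dg_hom A (dg_tgt A a) (dg_src A a)"
    if "a \<in> dg_basis A" "c \<in> Poly_Mapping.keys (dg_diff A a)" for a c
    using assms that unfolding dg_category_def by blast
  have keys_mult: "c \<in> dg_hom A (dg_tgt A a) (dg_src A b)"
    if "a \<in> dg_basis A" "b \<in> dg_basis A" "dg_src A a = dg_tgt A b"
      "c \<in> Poly_Mapping.keys (dg_mult A a b)" for a b c
    using assms that unfolding dg_category_def by blast
  have id_hom: "dg_id A S \<in> dg_hom A S S" for S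
    using assms unfolding dg_category_def by blast
  have rel: "mm_comp A (da_delta (da_identity A)) (da_delta (da_identity A)) x as
      + mm_diff_in A (da_delta (da_identity A)) x as
      + mm_mult_in A (da_delta (da_identity A)) x as
      + mm_diff_out A (da_delta (da_identity A)) x as = 0"
    if chain: "dg_chain A x as T" for x as T
  proof -
    show ?thesis
    proof (cases as rule: list_cases_upto_2)
      case 1
      then show ?thesis by (simp add: mm_comp_def mm_diff_in_def mm_mult_in_def mm_diff_out_def)
    next
      case (2 a)
      then have "lin (\<lambda>b. da_delta (da_identity A) x [b]) (dg_diff A a)
          = lin (\<lambda>b. bas (b, dg_src A a)) (dg_diff A a)"
        using chain by (intro lin_cong) (auto simp: dg_hom_def dest!: keys_diff [rotated])
      with 2 chain show ?thesis
        by (simp add: mm_comp_def mm_diff_in_def mm_mult_in_def mm_diff_out_def)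
    next
      case (3 a b)
      then have "lin (\<lambda>c. da_delta (da_identity A) x [c]) (dg_mult A a b)
          = lin (\<lambda>c. bas (c, dg_src A b)) (dg_mult A a b)"
        using chain by (intro lin_cong) (auto simp: dg_hom_def dest!: keys_mult [rotated -1])
      with 3 chain show ?thesis
        by (simp add: mm_comp_def mm_diff_in_def mm_mult_in_def mm_diff_out_def
            eval_nat_numeral case_prod_unfold)
    next
      case (4 a b c cs)
      then have "2 < length as" by simp
      then show ?thesis
        using mm_comp_arity [OF da_identity_arity [of A] da_identity_arity [of A], of A]
          mm_mult_in_arity [OF da_identity_arity [of A], of A] da_identity_arity [of A]
        by (simp add: mm_arity_le_def mm_diff_in_def mm_diff_out_def)
    qed
  qed
  show ?thesis
    unfolding da_bimodule_def
  proof (intro conjI ballI allI impI)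
    fix x as T
    assume "dg_chain A (da_right (da_identity A) x) as T"
    then show "case cy of (c, y) \<Rightarrow> y \<in> da_gens (da_identity A) \<and>
           c \<in> dg_hom A (da_left (da_identity A) x) (da_left (da_identity A) y) \<and>
           da_right (da_identity A) y = T \<and>
           da_deg (da_identity A) x + dg_shifted_deg A as =
           dg_shifted_deg A [c] + da_deg (da_identity A) y"
      if "cy \<in> Poly_Mapping.keys (da_delta (da_identity A) x as)" for cy
      using that
      by (cases as rule: remdups_adj.cases)
        (auto simp: dg_hom_def zero_prod_def [symmetric])
  next
    fix x as T
    assume "dg_chain A (da_right (da_identity A) x) as T" "1 < length as"
    then show "da_delta (da_identity A) x as = 0"
      using da_identity_arity [of A] by (simp add: mm_arity_le_def)
  next
    show "da_delta (da_identity A) x [dg_id A (da_right (da_identity A) x)]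
        = bas (dg_id A (da_left (da_identity A) x), x)" for x
      using id_hom by (simp add: dg_hom_def)
  qed (use assms rel in simp_all)
qed


section \<open>The change-of-basis bimodules and their box products\<close>

lemma A11_simps [simp]:
  "dg_basis A11 = UNIV" "dg_tgt A11 = std_tgt" "dg_src A11 = std_src" "dg_deg A11 = std_deg"
  "dg_id A11 = std_id" "dg_mult A11 = std_mult" "dg_diff A11 = (\<lambda>_. 0)"
  by (simp_all add: A11_def)

lemma A11can_simps [simp]:
  "dg_basis A11can = UNIV" "dg_tgt A11can = can_tgt" "dg_src A11can = can_src"
  "dg_deg A11can = can_deg" "dg_id A11can = can_id" "dg_mult A11can = can_mult"
  "dg_diff A11can = (\<lambda>_. 0)"
  by (simp_all add: A11can_def)

lemma range_std_id: "range std_id = {Id_uu, U1_ou 0, U2_uo 0, U12_oo 0 0}"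
  by (simp add: UNIV_std_obj)

lemma range_can_id: "range can_id = {Id_empty, U1_A 0, U1_B 0, U12_AB 0 0}"
  by (simp add: UNIV_can_obj)

lemma A11_chain_Cons:
  "dg_chain A11 S_uu (a # as) T \<longleftrightarrow> a = Id_uu \<and> dg_chain A11 S_uu as T"
  "dg_chain A11 S_ou (a # as) T \<longleftrightarrow> (\<exists>k. a = U1_ou k \<and> dg_chain A11 S_ou as T)"
  "dg_chain A11 S_uo (a # as) T \<longleftrightarrow>
     (\<exists>k. a = U2_uo k \<and> dg_chain A11 S_uo as T) \<or> a = Lam \<and> dg_chain A11 S_ou as T"
  "dg_chain A11 S_oo (a # as) T \<longleftrightarrow> (\<exists>k l. a = U12_oo k l \<and> dg_chain A11 S_oo as T)"
  by (cases a; auto)+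

lemma A11can_chain_Cons:
  "dg_chain A11can S_empty (a # as) T \<longleftrightarrow> a = Id_empty \<and> dg_chain A11can S_empty as T"
  "dg_chain A11can S_A (a # as) T \<longleftrightarrow>
     (\<exists>k. a = U1_A k \<and> dg_chain A11can S_A as T) \<or> (\<exists>k. a = R1U1 k \<and> dg_chain A11can S_B as T)"
  "dg_chain A11can S_B (a # as) T \<longleftrightarrow>
     (\<exists>k. a = U1_B k \<and> dg_chain A11can S_B as T) \<or> (\<exists>k. a = U2_B k \<and> dg_chain A11can S_B as T)
     \<or> (\<exists>k. a = L1U1 k \<and> dg_chain A11can S_A as T)"
  "dg_chain A11can S_AB (a # as) T \<longleftrightarrow> (\<exists>k l. a = U12_AB k l \<and> dg_chain A11can S_AB as T)"
  by (cases a; auto)+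

lemma KK_simps [simp]:
  "da_gens KK = UNIV" "da_left KK = K_left" "da_right KK = K_right"
  "da_deg KK x = (if x = kap3 then (- 1, 0) else (0, 0))"
  by (simp_all add: KK_def)

lemma LL_simps [simp]:
  "da_gens LL = UNIV" "da_left LL = L_left" "da_right LL = L_right"
  "da_deg LL x = (if x = lam3 then (- 1, 1) else (0, 0))"
  by (simp_all add: LL_def)

text \<open>The full operation tables, with the strictly unital ones merged into the others
  (exponent zero).\<close>
lemma KK_delta:
  "da_delta KK kap1 as = (case as of [Id_uu] \<Rightarrow> bas (Id_empty, kap1) | _ \<Rightarrow> 0)"
  "da_delta KK kap2 as = (case as of [U1_ou k] \<Rightarrow> bas (U1_A k, kap2) | _ \<Rightarrow> 0)"
  "da_delta KK kap3 as = (case as of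
       [] \<Rightarrow> bas (R1U1 0, kap4)
     | [Lam] \<Rightarrow> bas (U1_A 0, kap2)
     | [U2_uo 0] \<Rightarrow> bas (U1_A 0, kap3)
     | _ \<Rightarrow> 0)"
  "da_delta KK kap4 as = (case as of
       [U2_uo 0] \<Rightarrow> bas (U1_B 0, kap4)
     | [U2_uo (Suc k)] \<Rightarrow> bas (U2_B k, kap4)
     | [Lam, U1_ou (Suc k)] \<Rightarrow> bas (L1U1 k, kap2)
     | _ \<Rightarrow> 0)"
  "da_delta KK kap5 as = (case as of [U12_oo k l] \<Rightarrow> bas (U12_AB k l, kap5) | _ \<Rightarrow> 0)"
  by (auto simp: KK_def strictly_unital_delta_def K_ops_def range_std_id
      split: list.splits std_mor.splits nat.splits)

lemma LL_delta:
  "da_delta LL lam1 as = (case as of [Id_empty] \<Rightarrow> bas (Id_uu, lam1) | _ \<Rightarrow> 0)"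
  "da_delta LL lam2 as = (case as of
       [U1_A k] \<Rightarrow> bas (U1_ou k, lam2)
     | [R1U1 k] \<Rightarrow> bas (U1_ou k, lam3)
     | _ \<Rightarrow> 0)"
  "da_delta LL lam3 as = (case as of
       [U1_B k] \<Rightarrow> bas (U1_ou k, lam3)
     | [L1U1 k] \<Rightarrow> bas (U1_ou (k + 1), lam2)
     | _ \<Rightarrow> 0)"
  "da_delta LL lam4 as = (case as of
       [] \<Rightarrow> bas (Lam, lam3)
     | [U1_B 0] \<Rightarrow> bas (U2_uo 0, lam4)
     | [U2_B k] \<Rightarrow> bas (U2_uo (k + 1), lam4)
     | _ \<Rightarrow> 0)"
  "da_delta LL lam5 as = (case as of [U12_AB k l] \<Rightarrow> bas (U12_oo k l, lam5) | _ \<Rightarrow> 0)"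
  by (auto simp: LL_def strictly_unital_delta_def L_ops_def range_can_id
      split: list.splits can_mor.splits nat.splits)

lemma KK_arity: "mm_arity_le 2 (da_delta KK)"
proof -
  have "da_delta KK x as = 0" if "2 < length as" for x as
    using that by (cases x) (auto simp: KK_delta split: list.splits std_mor.splits nat.splits)
  then show ?thesis by (simp add: mm_arity_le_def)
qed

lemma LL_arity: "mm_arity_le 1 (da_delta LL)"
proof -
  have "da_delta LL x as = 0" if "1 < length as" for x as
    using that by (cases x) (auto simp: LL_delta split: list.splits can_mor.splits nat.splits)
  then show ?thesis by (simp add: mm_arity_le_def)
qed

lemma KL_gens:
  "da_gens (KK \<boxtimes> LL) =
     {(kap1, lam1), (kap2, lam2), (kap2, lam3), (kap3, lam4), (kap4, lam4), (kap5, lam5)}"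
  (is "?L = ?R")
proof -
  have "(x, y) \<in> ?L \<longleftrightarrow> (x, y) \<in> ?R" for x y
    by (cases x; cases y) auto
  then show ?thesis by auto
qed

lemma LK_gens:
  "da_gens (LL \<boxtimes> KK) =
     {(lam1, kap1), (lam2, kap2), (lam2, kap3), (lam3, kap4), (lam4, kap4), (lam5, kap5)}"
  (is "?L = ?R")
proof -
  have "(x, y) \<in> ?L \<longleftrightarrow> (x, y) \<in> ?R" for x y
    by (cases x; cases y) auto
  then show ?thesis by auto
qed

text \<open>Here \<open>(lam2, kap3)\<close> cancels against \<open>(lam3, kap4)\<close>; the operation of the identity
  bimodule on \<open>\<lambda>\<close> arises from the zigzag from \<open>(lam4, kap4)\<close> through this pair to
  \<open>(lam2, kap2)\<close>.\<close>
lemma LK_delta: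
  "da_delta (LL \<boxtimes> KK) (lam1, kap1) as = (case as of
       [Id_uu] \<Rightarrow> bas (Id_uu, (lam1, kap1)) | _ \<Rightarrow> 0)" (is ?case1)
  "da_delta (LL \<boxtimes> KK) (lam2, kap2) as = (case as of
       [U1_ou k] \<Rightarrow> bas (U1_ou k, (lam2, kap2)) | _ \<Rightarrow> 0)" (is ?case2)
  "da_delta (LL \<boxtimes> KK) (lam2, kap3) as = (case as of
       [] \<Rightarrow> bas (U1_ou 0, (lam3, kap4))
     | [Lam] \<Rightarrow> bas (U1_ou 0, (lam2, kap2))
     | [U2_uo 0] \<Rightarrow> bas (U1_ou 0, (lam2, kap3))
     | _ \<Rightarrow> 0)" (is ?case3)
  "da_delta (LL \<boxtimes> KK) (lam3, kap4) as = (case as of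
       [U2_uo 0] \<Rightarrow> bas (U1_ou 0, (lam3, kap4))
     | [Lam, U1_ou (Suc k)] \<Rightarrow> bas (U1_ou (k + 1), (lam2, kap2))
     | _ \<Rightarrow> 0)" (is ?case4)
  "da_delta (LL \<boxtimes> KK) (lam4, kap4) as = (case as of
       [] \<Rightarrow> bas (Lam, (lam3, kap4))
     | [U2_uo k] \<Rightarrow> bas (U2_uo k, (lam4, kap4))
     | _ \<Rightarrow> 0)" (is ?case5)
  "da_delta (LL \<boxtimes> KK) (lam5, kap5) as = (case as of
       [U12_oo k l] \<Rightarrow> bas (U12_oo k l, (lam5, kap5)) | _ \<Rightarrow> 0)" (is ?case6)
proof -
  have expand: "da_delta (LL \<boxtimes> KK) z as = box_term LL KK 0 z as + box_term LL KK 1 z as" for z as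
    by (simp add: box_delta_arity [OF LL_arity])
  note short = expand [of _ "[]"] expand [of _ "[_]"] expand [of _ "[_, _]"]
  have long: "da_delta (LL \<boxtimes> KK) z (a # b # c # cs) = 0" for z a b c cs
    by (rule mm_arityD [OF box_prod_arity [OF LL_arity KK_arity]]) simp
  show ?case1 ?case2 ?case3 ?case4 ?case5 ?case6
    by (cases as rule: list_cases_upto_2;
        simp add: short long box_term_def KK_delta LL_delta split: std_mor.split nat.split)+
qed

text \<open>Here \<open>(kap3, lam4)\<close> cancels against \<open>(kap2, lam3)\<close>; eliminating this pair identifies
  \<open>(kap2, lam3)\<close> with \<open>R\<^sub>1 \<otimes> (kap4, lam4)\<close>.\<close>
lemma KL_delta:
  "da_delta (KK \<boxtimes> LL) (kap1, lam1) as = (case as of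
       [Id_empty] \<Rightarrow> bas (Id_empty, (kap1, lam1)) | _ \<Rightarrow> 0)" (is ?case1)
  "da_delta (KK \<boxtimes> LL) (kap2, lam2) as = (case as of
       [U1_A k] \<Rightarrow> bas (U1_A k, (kap2, lam2))
     | [R1U1 k] \<Rightarrow> bas (U1_A k, (kap2, lam3))
     | _ \<Rightarrow> 0)" (is ?case2)
  "da_delta (KK \<boxtimes> LL) (kap2, lam3) as = (case as of
       [U1_B k] \<Rightarrow> bas (U1_A k, (kap2, lam3))
     | [L1U1 k] \<Rightarrow> bas (U1_A (k + 1), (kap2, lam2))
     | _ \<Rightarrow> 0)" (is ?case3)
  "da_delta (KK \<boxtimes> LL) (kap3, lam4) as = (case as of
       [] \<Rightarrow> bas (R1U1 0, (kap4, lam4)) + bas (U1_A 0, (kap2, lam3))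
     | [U1_B 0] \<Rightarrow> bas (U1_A 0, (kap3, lam4))
     | _ \<Rightarrow> 0)" (is ?case4)
  "da_delta (KK \<boxtimes> LL) (kap4, lam4) as = (case as of
       [U1_B 0] \<Rightarrow> bas (U1_B 0, (kap4, lam4))
     | [U1_B (Suc k)] \<Rightarrow> bas (L1U1 k, (kap2, lam3))
     | [U2_B k] \<Rightarrow> bas (U2_B k, (kap4, lam4))
     | [L1U1 k] \<Rightarrow> bas (L1U1 k, (kap2, lam2))
     | _ \<Rightarrow> 0)" (is ?case5)
  "da_delta (KK \<boxtimes> LL) (kap5, lam5) as = (case as of
       [U12_AB k l] \<Rightarrow> bas (U12_AB k l, (kap5, lam5)) | _ \<Rightarrow> 0)" (is ?case6)
proof -
  have expand: "da_delta (KK \<boxtimes> LL) z as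
      = box_term KK LL 0 z as + box_term KK LL 1 z as + box_term KK LL 2 z as" for z as
    by (simp add: box_delta_arity [OF KK_arity] eval_nat_numeral)
  note short = expand [of _ "[]"] expand [of _ "[_]"] expand [of _ "[_, _]"]
  have long: "da_delta (KK \<boxtimes> LL) z (a # b # c # cs) = 0" for z a b c cs
    by (rule mm_arityD [OF box_prod_arity [OF KK_arity LL_arity]]) simp
  show ?case1 ?case2 ?case3 ?case4 ?case5 ?case6
    by (cases as rule: list_cases_upto_2;
        simp add: short long box_term_def KK_delta LL_delta eval_nat_numeral
          split: can_mor.split nat.split)+
qed

text \<open>The bound 2 from the two factors is not sharp.  On two inputs, the operation of \<open>LL\<close> has to
  be applied twice, with one input each time.  But \<open>KK\<close> accepts two algebra elements only if the
  first is \<open>\<lambda>\<close>, and \<open>LL\<close> outputs \<open>\<lambda>\<close> only without input.\<close>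
lemma KL_arity: "mm_arity_le 1 (da_delta (KK \<boxtimes> LL))"
proof -
  have two: "da_delta (KK \<boxtimes> LL) (x, y) [a, b] = 0" for x y a b
  proof -
    have "da_delta (KK \<boxtimes> LL) (x, y) [a, b] = box_term KK LL 2 (x, y) [a, b]"
      by (simp add: box_delta_arity [OF KK_arity] box_term_def eval_nat_numeral
          mm_arityD [OF LL_arity] case_prod_unfold)
    also have "\<dots> = 0"
      by (cases x; cases y; cases a;
        simp add: box_term_def eval_nat_numeral KK_delta LL_delta
          split: can_mor.split nat.split)
    finally show ?thesis .
  qed
  have "da_delta (KK \<boxtimes> LL) z as = 0" if "1 < length as" for z as
  proof (cases as rule: list_cases_upto_2)
    case (3 a b)
    with two show ?thesis by (cases z) simp
  next
    case (4 a b c cs)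
    with mm_arityD [OF box_prod_arity [OF KK_arity LL_arity], of as z] show ?thesis by simp
  qed (use that in simp_all)
  then show ?thesis by (simp only: mm_arity_le_def) blast
qed

lemma LK_arity: "mm_arity_le 2 (da_delta (LL \<boxtimes> KK))"
  using box_prod_arity [OF LL_arity KK_arity] by simp

lemma plus_A11: "a \<in> dg_plus A11 \<longleftrightarrow> a \<notin> {Id_uu, U1_ou 0, U2_uo 0, U12_oo 0 0}"
  unfolding dg_plus_def by (simp add: range_std_id)

lemma plus_A11can: "a \<in> dg_plus A11can \<longleftrightarrow> a \<notin> {Id_empty, U1_A 0, U1_B 0, U12_AB 0 0}"
  unfolding dg_plus_def by (simp add: range_can_id)

lemmas mm_evaluate = mm_comp_def mm_mult_in_def eval_nat_numeral


section \<open>Structure relations\<close>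

lemma da_bimodule_KK: "da_bimodule A11can A11 KK"
proof (rule da_bimodule_boundedI [OF dg_category_A11can dg_category_A11 _ _ KK_arity])
  fix x as T
  assume *: "dg_chain A11 (da_right KK x) as T" "length as \<le> 2 * 2"
  show "mm_comp A11can (da_delta KK) (da_delta KK) x as = mm_mult_in A11 (da_delta KK) x as"
    using * by (cases as rule: list_cases_upto_4; cases x;
      auto simp: A11_chain_Cons mm_evaluate KK_delta simp del: dg_chain.simps(2) split: nat.splits)
next
  fix x as T c y
  assume "dg_chain A11 (da_right KK x) as T" "length as \<le> 2"
    "(c, y) \<in> Poly_Mapping.keys (da_delta KK x as)"
  then show "y \<in> da_gens KK \<and> c \<in> dg_hom A11can (da_left KK x) (da_left KK y) \<and> da_right KK y = T \<and>
        da_deg KK x + dg_shifted_deg A11 as = dg_shifted_deg A11can [c] + da_deg KK y"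
    by (cases as rule: list_cases_upto_2; cases x;
      auto simp: A11_chain_Cons KK_delta dg_hom_def dg_shifted_deg_def
        simp del: dg_chain.simps(2) split: nat.splits)
next
  fix x
  show "da_delta KK x [dg_id A11 (da_right KK x)] = bas (dg_id A11can (da_left KK x), x)"
    by (cases x) (auto simp: KK_delta)
next
  fix x as T
  assume "dg_chain A11 (da_right KK x) as T" "1 < length as" "length as \<le> 2"
    "set as \<inter> range (dg_id A11) \<noteq> {}"
  then show "da_delta KK x as = 0"
    by (cases as rule: list_cases_upto_2; cases x)
      (auto simp: KK_delta range_std_id split: std_mor.splits nat.splits)
qed simp_all

lemma da_bimodule_LL: "da_bimodule A11 A11can LL"
proof (rule da_bimodule_boundedI [OF dg_category_A11 dg_category_A11can _ _ LL_arity])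
  fix x as T
  assume *: "dg_chain A11can (da_right LL x) as T" "length as \<le> 2 * 1"
  show "mm_comp A11 (da_delta LL) (da_delta LL) x as = mm_mult_in A11can (da_delta LL) x as"
    using * by (cases as rule: list_cases_upto_2; cases x;
      auto simp: A11can_chain_Cons mm_evaluate LL_delta simp del: dg_chain.simps(2) split: nat.splits)
next
  fix x as T c y
  assume "dg_chain A11can (da_right LL x) as T" "length as \<le> 1"
    "(c, y) \<in> Poly_Mapping.keys (da_delta LL x as)"
  then show "y \<in> da_gens LL \<and> c \<in> dg_hom A11 (da_left LL x) (da_left LL y) \<and> da_right LL y = T \<and>
        da_deg LL x + dg_shifted_deg A11can as = dg_shifted_deg A11 [c] + da_deg LL y"
    by (cases as rule: list_cases_upto_2; cases x;
      auto simp: A11can_chain_Cons LL_delta dg_hom_def dg_shifted_deg_def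
        simp del: dg_chain.simps(2) split: nat.splits)
next
  fix x
  show "da_delta LL x [dg_id A11can (da_right LL x)] = bas (dg_id A11 (da_left LL x), x)"
    by (cases x) (auto simp: LL_delta)
qed simp_all

lemma da_bimodule_KL: "da_bimodule A11can A11can (KK \<boxtimes> LL)"
proof (rule da_bimodule_boundedI [OF dg_category_A11can dg_category_A11can])
  show "mm_arity_le 1 (da_delta (KK \<boxtimes> LL))"
    by (rule KL_arity)
next
  fix z as T
  assume "z \<in> da_gens (KK \<boxtimes> LL)" "dg_chain A11can (da_right (KK \<boxtimes> LL) z) as T"
    "length as \<le> 2 * 1"
  then show "mm_comp A11can (da_delta (KK \<boxtimes> LL)) (da_delta (KK \<boxtimes> LL)) z as
      = mm_mult_in A11can (da_delta (KK \<boxtimes> LL)) z as"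
    unfolding KL_gens
    by (cases as rule: list_cases_upto_2;
      auto simp: A11can_chain_Cons mm_evaluate KL_delta simp del: dg_chain.simps(2) split: nat.splits)
next
  fix z as T c y
  assume "z \<in> da_gens (KK \<boxtimes> LL)" "dg_chain A11can (da_right (KK \<boxtimes> LL) z) as T"
    "length as \<le> 1" "(c, y) \<in> Poly_Mapping.keys (da_delta (KK \<boxtimes> LL) z as)"
  then show "y \<in> da_gens (KK \<boxtimes> LL) \<and>
      c \<in> dg_hom A11can (da_left (KK \<boxtimes> LL) z) (da_left (KK \<boxtimes> LL) y) \<and> da_right (KK \<boxtimes> LL) y = T \<and>
        da_deg (KK \<boxtimes> LL) z + dg_shifted_deg A11can as
          = dg_shifted_deg A11can [c] + da_deg (KK \<boxtimes> LL) y"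
    unfolding KL_gens
    by (cases as rule: list_cases_upto_2;
      auto simp: A11can_chain_Cons KL_delta dg_hom_def dg_shifted_deg_def
        simp del: dg_chain.simps(2) split: nat.splits)
next
  fix z
  assume "z \<in> da_gens (KK \<boxtimes> LL)"
  then show "da_delta (KK \<boxtimes> LL) z [dg_id A11can (da_right (KK \<boxtimes> LL) z)]
      = bas (dg_id A11can (da_left (KK \<boxtimes> LL) z), z)"
    unfolding KL_gens by (auto simp: KL_delta)
qed simp_all

lemma da_bimodule_LK: "da_bimodule A11 A11 (LL \<boxtimes> KK)"
proof (rule da_bimodule_boundedI [OF dg_category_A11 dg_category_A11])
  show "mm_arity_le 2 (da_delta (LL \<boxtimes> KK))"
    by (rule LK_arity)
next
  fix z as T
  assume "z \<in> da_gens (LL \<boxtimes> KK)" "dg_chain A11 (da_right (LL \<boxtimes> KK) z) as T"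
    "length as \<le> 2 * 2"
  then show "mm_comp A11 (da_delta (LL \<boxtimes> KK)) (da_delta (LL \<boxtimes> KK)) z as
      = mm_mult_in A11 (da_delta (LL \<boxtimes> KK)) z as"
    unfolding LK_gens
    by (cases as rule: list_cases_upto_4;
      auto simp: A11_chain_Cons mm_evaluate LK_delta simp del: dg_chain.simps(2) split: nat.splits)
next
  fix z as T c y
  assume "z \<in> da_gens (LL \<boxtimes> KK)" "dg_chain A11 (da_right (LL \<boxtimes> KK) z) as T"
    "length as \<le> 2" "(c, y) \<in> Poly_Mapping.keys (da_delta (LL \<boxtimes> KK) z as)"
  then show "y \<in> da_gens (LL \<boxtimes> KK) \<and>
      c \<in> dg_hom A11 (da_left (LL \<boxtimes> KK) z) (da_left (LL \<boxtimes> KK) y) \<and> da_right (LL \<boxtimes> KK) y = T \<and>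
        da_deg (LL \<boxtimes> KK) z + dg_shifted_deg A11 as
          = dg_shifted_deg A11 [c] + da_deg (LL \<boxtimes> KK) y"
    unfolding LK_gens
    by (cases as rule: list_cases_upto_2;
      auto simp: A11_chain_Cons LK_delta dg_hom_def dg_shifted_deg_def
        simp del: dg_chain.simps(2) split: nat.splits)
next
  fix z
  assume "z \<in> da_gens (LL \<boxtimes> KK)"
  then show "da_delta (LL \<boxtimes> KK) z [dg_id A11 (da_right (LL \<boxtimes> KK) z)]
      = bas (dg_id A11 (da_left (LL \<boxtimes> KK) z), z)"
    unfolding LK_gens by (auto simp: LK_delta)
next
  fix z as T
  assume "z \<in> da_gens (LL \<boxtimes> KK)" "1 < length as" "length as \<le> 2" "set as \<inter> range (dg_id A11) \<noteq> {}"
  then show "da_delta (LL \<boxtimes> KK) z as = 0"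
    unfolding LK_gens
    by (cases as rule: list_cases_upto_2;
      auto simp: LK_delta range_std_id split: std_mor.split nat.split)
qed simp_all


section \<open>Homotopy equivalences detected on short inputs\<close>

lemma mm_comp_zero [simp]:
  "mm_comp A' (\<lambda>_ _. 0) f = (\<lambda>_ _. 0)" "mm_comp A' g (\<lambda>_ _. 0) = (\<lambda>_ _. 0)"
  by (simp_all add: mm_comp_def case_prod_unfold fun_eq_iff)

lemma da_mor_diff_zero [simp]: "da_mor_diff A' A M N (\<lambda>_ _. 0) = (\<lambda>_ _. 0)"
  by (simp add: da_mor_diff_def mm_diff_in_def mm_mult_in_def mm_diff_out_def fun_eq_iff)

lemma da_morphism_zero: "da_morphism A' A M N d (\<lambda>_ _. 0)"
  by (simp add: da_morphism_def)

lemma dg_chain_append: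
  "dg_chain A S (as @ bs) T \<longleftrightarrow> (\<exists>S'. dg_chain A S as S' \<and> dg_chain A S' bs T)"
  by (induction as arbitrary: S) auto

text \<open>Outside the composable strings of non-identity elements, a composite of morphisms takes the
  value 0, as the convention on morphisms requires.\<close>
lemma mm_comp_support:
  assumes f: "da_morphism A' A M N d f" and g: "da_morphism A' A N P e g"
    and "\<not> da_plus_input A M x as"
  shows "mm_comp A' g f x as = 0"
  unfolding mm_comp_def
proof (rule sum.neutral, rule ballI, rule lin_eq_0I, clarify)
  fix p c y
  assume cy: "(c, y) \<in> Poly_Mapping.keys (f x (take p as))"
  then have "f x (take p as) \<noteq> 0" by auto
  then have plus: "da_plus_input A M x (take p as)"
    using f unfolding da_morphism_def by blast
  then obtain T where T: "dg_chain A (da_right M x) (take p as) T"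
    unfolding da_plus_input_def by blast
  with f plus cy have y: "da_right N y = T"
    unfolding da_morphism_def by fast
  have "\<not> da_plus_input A N y (drop p as)"
  proof
    assume "da_plus_input A N y (drop p as)"
    then obtain T' where "dg_chain A T (drop p as) T'" "set (drop p as) \<subseteq> dg_plus A"
      unfolding da_plus_input_def y by blast
    moreover have "x \<in> da_gens M" "set (take p as) \<subseteq> dg_plus A"
      using plus unfolding da_plus_input_def by auto
    ultimately have "da_plus_input A M x (take p as @ drop p as)"
      using T unfolding da_plus_input_def dg_chain_append set_append by blast
    with assms(3) show False by simp
  qed
  then have "g y (drop p as) = 0"
    using g unfolding da_morphism_def by blast
  then show "lin (\<lambda>(c', z). lin (\<lambda>b. bas (b, z)) (dg_mult A' c c')) (g y (drop p as)) = 0"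
    by simp
qed

text \<open>An equation \<open>d f = e\<close> between morphisms of bounded arity needs to be checked only on
  finitely many input lengths.\<close>
lemma da_mor_diff_boundedI:
  fixes f :: "('m, 'a, 'c, 'n) multi_map"
  assumes diff: "dg_diff A' = (\<lambda>_. 0)" "dg_diff A = (\<lambda>_. 0)"
    and M: "mm_arity_le m (da_delta M)" and N: "mm_arity_le m (da_delta N)" and m: "0 < m"
    and f: "mm_arity_le n f" and e: "mm_arity_le l e" "l \<le> n + m"
      "\<And>x as. \<not> da_plus_input A M x as \<Longrightarrow> e x as = 0"
    and eq: "\<And>x as T. x \<in> da_gens M \<Longrightarrow> dg_chain A (da_right M x) as T \<Longrightarrow>
        set as \<subseteq> dg_plus A \<Longrightarrow> length as \<le> n + m \<Longrightarrow>
        mm_comp A' (da_delta N) f x as + mm_comp A' f (da_delta M) x as + mm_mult_in A f x as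
          = e x as"
  shows "da_mor_diff A' A M N f = e"
proof (intro ext)
  fix x and as :: "'a list"
  show "da_mor_diff A' A M N f x as = e x as"
  proof (cases "da_plus_input A M x as")
    case False
    then show ?thesis
      using e(3) by (simp add: da_mor_diff_def)
  next
    case True
    then obtain T where xas: "x \<in> da_gens M" "dg_chain A (da_right M x) as T"
      "set as \<subseteq> dg_plus A"
      unfolding da_plus_input_def by blast
    have "mm_comp A' (da_delta N) f x as + mm_comp A' f (da_delta M) x as + mm_mult_in A f x as
          = e x as"
    proof (cases "length as \<le> n + m")
      case True
      with eq xas show ?thesis by blast
    next
      case False
      then have "n + m < length as" "m + n < length as" "Suc n < length as" "l < length as"
        using m e(2) by linarith+
      then show ?thesis
        by (simp add: mm_arityD [OF mm_comp_arity [OF f N]] mm_arityD [OF mm_comp_arity [OF M f]]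
            mm_arityD [OF mm_mult_in_arity [OF f]] mm_arityD [OF e(1)])
    qed
    with True show ?thesis
      by (simp add: da_mor_diff_def mm_diff_out_zero [OF diff(1)] mm_diff_in_zero [OF diff(2)])
  qed
qed

lemma da_plus_input_Nil [simp]: "da_plus_input A M x [] \<longleftrightarrow> x \<in> da_gens M"
  by (simp add: da_plus_input_def)

lemma da_mor_id_arity: "mm_arity_le 0 (da_mor_id A' M)"
  by (simp add: mm_arity_le_def da_mor_id_def)

text \<open>A deformation retraction: \<open>f\<close> after \<open>g\<close> is the identity on the nose, and \<open>h\<close> is a
  homotopy from \<open>g\<close> after \<open>f\<close> to the identity.  All equations are needed only on short inputs.\<close>
lemma da_homotopy_equiv_retractI:
  fixes f :: "('m, 'a, 'c, 'n) multi_map"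
  assumes diff: "dg_diff A' = (\<lambda>_. 0)" "dg_diff A = (\<lambda>_. 0)"
    and M: "da_bimodule A' A M" "mm_arity_le m (da_delta M)"
    and N: "da_bimodule A' A N" "mm_arity_le m (da_delta N)" and m: "0 < m"
    and f: "da_morphism A' A M N (0, 0) f" "mm_arity_le p f"
    and g: "da_morphism A' A N M (0, 0) g" "mm_arity_le q g"
    and h: "da_morphism A' A M M (0, - 1) h" "mm_arity_le r h" and pq: "p + q \<le> r + m"
    and f_cycle: "\<And>x as T. x \<in> da_gens M \<Longrightarrow> dg_chain A (da_right M x) as T \<Longrightarrow>
        set as \<subseteq> dg_plus A \<Longrightarrow> length as \<le> p + m \<Longrightarrow>
        mm_comp A' (da_delta N) f x as + mm_comp A' f (da_delta M) x as + mm_mult_in A f x as = 0"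
    and g_cycle: "\<And>y as T. y \<in> da_gens N \<Longrightarrow> dg_chain A (da_right N y) as T \<Longrightarrow>
        set as \<subseteq> dg_plus A \<Longrightarrow> length as \<le> q + m \<Longrightarrow>
        mm_comp A' (da_delta M) g y as + mm_comp A' g (da_delta N) y as + mm_mult_in A g y as = 0"
    and htpy: "\<And>x as T. x \<in> da_gens M \<Longrightarrow> dg_chain A (da_right M x) as T \<Longrightarrow>
        set as \<subseteq> dg_plus A \<Longrightarrow> length as \<le> r + m \<Longrightarrow>
        mm_comp A' (da_delta M) h x as + mm_comp A' h (da_delta M) x as + mm_mult_in A h x as
          = mm_comp A' g f x as + da_mor_id A' M x as"
    and retract: "\<And>y as T. y \<in> da_gens N \<Longrightarrow> dg_chain A (da_right N y) as T \<Longrightarrow>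
        set as \<subseteq> dg_plus A \<Longrightarrow> length as \<le> p + q \<Longrightarrow>
        mm_comp A' f g y as = da_mor_id A' N y as"
  shows "da_homotopy_equiv A' A M N"
proof -
  have zero: "mm_arity_le 0 (\<lambda>_ _. 0 :: ('c \<times> 'k) f2)"
    by (simp add: mm_arity_le_def)
  have "da_mor_diff A' A M N f = (\<lambda>_ _. 0)"
    by (rule da_mor_diff_boundedI [OF diff M(2) N(2) m f(2) zero]) (use f_cycle in auto)
  moreover have "da_mor_diff A' A N M g = (\<lambda>_ _. 0)"
    by (rule da_mor_diff_boundedI [OF diff N(2) M(2) m g(2) zero]) (use g_cycle in auto)
  moreover have "da_mor_diff A' A M M h = (\<lambda>x as. mm_comp A' g f x as + da_mor_id A' M x as)"
  proof (rule da_mor_diff_boundedI [OF diff M(2) M(2) m h(2) _ pq])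
    show "mm_arity_le (p + q) (\<lambda>x as. mm_comp A' g f x as + da_mor_id A' M x as)"
      using f(2) g(2) by (intro mm_arity_add mm_comp_arity mm_arity_mono [OF da_mor_id_arity]) auto
    show "mm_comp A' g f x as + da_mor_id A' M x as = 0" if "\<not> da_plus_input A M x as" for x as
      using mm_comp_support [OF f(1) g(1) that] that by (auto simp: da_mor_id_def)
  qed (use htpy in auto)
  moreover have "mm_comp A' f g y as = da_mor_id A' N y as" for y as
  proof (cases "da_plus_input A N y as")
    case False
    with mm_comp_support [OF g(1) f(1) False] show ?thesis
      by (auto simp: da_mor_id_def)
  next
    case True
    then obtain T where y: "y \<in> da_gens N" "dg_chain A (da_right N y) as T" "set as \<subseteq> dg_plus A"
      unfolding da_plus_input_def by blast
    show ?thesis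
    proof (cases "length as \<le> p + q")
      case True
      with retract y show ?thesis by blast
    next
      case False
      with mm_arityD [OF mm_comp_arity [OF g(2) f(2)], of as] show ?thesis
        by (auto simp: da_mor_id_def)
    qed
  qed
  \<comment> \<open>The homotopy on \<open>N\<close> is 0, and the differences in the definition are sums over \<open>\<F>\<^sub>2\<close>.\<close>
  ultimately show ?thesis
    unfolding da_homotopy_equiv_def
    using M(1) N(1) f(1) g(1) h(1) da_morphism_zero [of A' A N N "(0, - 1)"]
    by (intro conjI exI [of _ f] exI [of _ g] exI [of _ h] exI [of _ "\<lambda>_ _. 0"]) simp_all
qed

lemma da_morphism_boundedI:
  assumes n: "mm_arity_le n f"
    and supp: "\<And>x as. length as \<le> n \<Longrightarrow> f x as \<noteq> 0 \<Longrightarrow> da_plus_input A M x as"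
    and graded: "\<And>x as T c y. x \<in> da_gens M \<Longrightarrow> dg_chain A (da_right M x) as T \<Longrightarrow> length as \<le> n \<Longrightarrow>
        (c, y) \<in> Poly_Mapping.keys (f x as) \<Longrightarrow>
        y \<in> da_gens N \<and> c \<in> dg_hom A' (da_left M x) (da_left N y) \<and> da_right N y = T \<and>
        da_deg M x + dg_shifted_deg A as + d = dg_deg A' c + da_deg N y"
  shows "da_morphism A' A M N d f"
  unfolding da_morphism_def
proof (intro conjI allI impI ballI)
  fix x as
  assume "\<not> da_plus_input A M x as"
  then show "f x as = 0"
    using supp mm_arityD [OF n] not_le by blast
next
  fix x as T cy
  assume *: "da_plus_input A M x as" "dg_chain A (da_right M x) as T"
    "cy \<in> Poly_Mapping.keys (f x as)"
  obtain c y where cy: "cy = (c, y)" by (cases cy)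
  have "length as \<le> n"
    using mm_arityD [OF n, of as x] *(3) by (cases "length as \<le> n") auto
  with graded [of x as T c y] * show "case cy of (c, y) \<Rightarrow> y \<in> da_gens N \<and>
        c \<in> dg_hom A' (da_left M x) (da_left N y) \<and> da_right N y = T \<and>
        da_deg M x + dg_shifted_deg A as + d = dg_deg A' c + da_deg N y"
    by (simp add: cy da_plus_input_def)
qed


section \<open>Deformation retractions onto the identity bimodules\<close>

text \<open>Projection of \<open>KK \<boxtimes> LL\<close> onto the identity bimodule.  Since \<open>(kap3, lam4)\<close> goes
  to 0, so does its differential \<open>R\<^sub>1 \<otimes> (kap4, lam4) + (kap2, lam3)\<close>; this determines the value
  \<open>R\<^sub>1\<close> on \<open>(kap2, lam3)\<close>.  There are no components with algebra inputs.\<close>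
definition KL_proj :: "(K_gen \<times> L_gen, can_mor, can_mor, can_obj) multi_map" where
  "KL_proj z as = (case (z, as) of
       ((kap1, lam1), []) \<Rightarrow> bas (Id_empty, S_empty)
     | ((kap2, lam2), []) \<Rightarrow> bas (U1_A 0, S_A)
     | ((kap2, lam3), []) \<Rightarrow> bas (R1U1 0, S_B)
     | ((kap4, lam4), []) \<Rightarrow> bas (U1_B 0, S_B)
     | ((kap5, lam5), []) \<Rightarrow> bas (U12_AB 0 0, S_AB)
     | _ \<Rightarrow> 0)"

text \<open>Inclusion of the identity bimodule.  The components with one input correct the operations
  of \<open>KK \<boxtimes> LL\<close> that end in \<open>(kap2, lam3)\<close>, by the preimage \<open>(kap3, lam4)\<close> under the
  cancelled arrow.\<close>
definition KL_incl :: "(can_obj, can_mor, can_mor, K_gen \<times> L_gen) multi_map" where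
  "KL_incl S as = (case (S, as) of
       (S_empty, []) \<Rightarrow> bas (Id_empty, (kap1, lam1))
     | (S_A, []) \<Rightarrow> bas (U1_A 0, (kap2, lam2))
     | (S_A, [R1U1 k]) \<Rightarrow> bas (U1_A k, (kap3, lam4))
     | (S_B, []) \<Rightarrow> bas (U1_B 0, (kap4, lam4))
     | (S_B, [U1_B (Suc k)]) \<Rightarrow> bas (L1U1 k, (kap3, lam4))
     | (S_AB, []) \<Rightarrow> bas (U12_AB 0 0, (kap5, lam5))
     | _ \<Rightarrow> 0)"

text \<open>The inverse of the cancelled arrow from \<open>(kap3, lam4)\<close> to \<open>(kap2, lam3)\<close>.\<close>
definition KL_htpy :: "(K_gen \<times> L_gen, can_mor, can_mor, K_gen \<times> L_gen) multi_map" where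
  "KL_htpy z as = (if z = (kap2, lam3) \<and> as = [] then bas (U1_A 0, (kap3, lam4)) else 0)"

text \<open>Projection of \<open>LL \<boxtimes> KK\<close> onto the identity bimodule.  The component on \<open>\<lambda>\<close> is forced by
  the operation of the identity bimodule on \<open>\<lambda>\<close>, because the differential of
  \<open>(lam4, kap4)\<close> is \<open>\<lambda> \<otimes> (lam3, kap4)\<close>.\<close>
definition LK_proj :: "(L_gen \<times> K_gen, std_mor, std_mor, std_obj) multi_map" where
  "LK_proj z as = (case (z, as) of
       ((lam1, kap1), []) \<Rightarrow> bas (Id_uu, S_uu)
     | ((lam2, kap2), []) \<Rightarrow> bas (U1_ou 0, S_ou)
     | ((lam3, kap4), [Lam]) \<Rightarrow> bas (U1_ou 0, S_ou)
     | ((lam4, kap4), []) \<Rightarrow> bas (U2_uo 0, S_uo)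
     | ((lam5, kap5), []) \<Rightarrow> bas (U12_oo 0 0, S_oo)
     | _ \<Rightarrow> 0)"

text \<open>Inclusion of the identity bimodule.  The summand \<open>\<lambda> \<otimes> (lam2, kap3)\<close> cancels the
  differential of \<open>(lam4, kap4)\<close>.  There are no components with algebra inputs.\<close>
definition LK_incl :: "(std_obj, std_mor, std_mor, L_gen \<times> K_gen) multi_map" where
  "LK_incl S as = (case (S, as) of
       (S_uu, []) \<Rightarrow> bas (Id_uu, (lam1, kap1))
     | (S_ou, []) \<Rightarrow> bas (U1_ou 0, (lam2, kap2))
     | (S_uo, []) \<Rightarrow> bas (U2_uo 0, (lam4, kap4)) + bas (Lam, (lam2, kap3))
     | (S_oo, []) \<Rightarrow> bas (U12_oo 0 0, (lam5, kap5))
     | _ \<Rightarrow> 0)"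

text \<open>The inverse of the cancelled arrow from \<open>(lam2, kap3)\<close> to \<open>(lam3, kap4)\<close>.\<close>
definition LK_htpy :: "(L_gen \<times> K_gen, std_mor, std_mor, L_gen \<times> K_gen) multi_map" where
  "LK_htpy z as = (if z = (lam3, kap4) \<and> as = [] then bas (U1_ou 0, (lam2, kap3)) else 0)"

lemma KL_proj_arity: "mm_arity_le 0 KL_proj"
  by (auto simp: mm_arity_le_def KL_proj_def split: list.split K_gen.split L_gen.split)

lemma KL_incl_arity: "mm_arity_le 1 KL_incl"
  by (auto simp: mm_arity_le_def KL_incl_def split: list.split can_obj.split can_mor.split nat.split)

lemma KL_htpy_arity: "mm_arity_le 0 KL_htpy"
  by (auto simp: mm_arity_le_def KL_htpy_def)

lemma LK_proj_arity: "mm_arity_le 1 LK_proj"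
  by (auto simp: mm_arity_le_def LK_proj_def split: list.split K_gen.split L_gen.split std_mor.split)

lemma LK_incl_arity: "mm_arity_le 0 LK_incl"
  by (auto simp: mm_arity_le_def LK_incl_def split: list.split std_obj.split)

lemma LK_htpy_arity: "mm_arity_le 0 LK_htpy"
  by (auto simp: mm_arity_le_def LK_htpy_def)

lemma KL_homotopy_equiv: "da_homotopy_equiv A11can A11can (KK \<boxtimes> LL) (da_identity A11can)"
proof (rule da_homotopy_equiv_retractI [OF _ _ da_bimodule_KL KL_arity
      da_bimodule_identity [OF dg_category_A11can] da_identity_arity _ _ KL_proj_arity
      _ KL_incl_arity _ KL_htpy_arity])
  show "da_morphism A11can A11can (KK \<boxtimes> LL) (da_identity A11can) (0, 0) KL_proj"
  proof (rule da_morphism_boundedI [OF KL_proj_arity])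
    fix z and as :: "can_mor list"
    assume "length as \<le> 0" "KL_proj z as \<noteq> 0"
    then show "da_plus_input A11can (KK \<boxtimes> LL) z as"
      by (cases z; cases "fst z"; cases "snd z") (auto simp: KL_proj_def)
  next
    fix z as T c y
    assume "z \<in> da_gens (KK \<boxtimes> LL)" "dg_chain A11can (da_right (KK \<boxtimes> LL) z) as T"
      "length as \<le> 0" "(c, y) \<in> Poly_Mapping.keys (KL_proj z as)"
    then show "y \<in> da_gens (da_identity A11can) \<and>
        c \<in> dg_hom A11can (da_left (KK \<boxtimes> LL) z) (da_left (da_identity A11can) y) \<and>
        da_right (da_identity A11can) y = T \<and>
        da_deg (KK \<boxtimes> LL) z + dg_shifted_deg A11can as + (0, 0)
          = dg_deg A11can c + da_deg (da_identity A11can) y"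
      unfolding KL_gens by (auto simp: KL_proj_def dg_hom_def dg_shifted_deg_def)
  qed
  show "da_morphism A11can A11can (da_identity A11can) (KK \<boxtimes> LL) (0, 0) KL_incl"
  proof (rule da_morphism_boundedI [OF KL_incl_arity])
    fix S and as :: "can_mor list"
    assume "length as \<le> 1" "KL_incl S as \<noteq> 0"
    then show "da_plus_input A11can (da_identity A11can) S as"
      by (cases as rule: list_cases_upto_2; cases S)
        (auto simp: KL_incl_def da_plus_input_def plus_A11can split: can_mor.splits nat.splits)
  next
    fix S as T c z
    assume "dg_chain A11can (da_right (da_identity A11can) S) as T"
      "length as \<le> 1" "(c, z) \<in> Poly_Mapping.keys (KL_incl S as)"
    then show "z \<in> da_gens (KK \<boxtimes> LL) \<and>
        c \<in> dg_hom A11can (da_left (da_identity A11can) S) (da_left (KK \<boxtimes> LL) z) \<and>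
        da_right (KK \<boxtimes> LL) z = T \<and>
        da_deg (da_identity A11can) S + dg_shifted_deg A11can as + (0, 0)
          = dg_deg A11can c + da_deg (KK \<boxtimes> LL) z"
      by (cases as rule: list_cases_upto_2; cases S)
        (auto simp: KL_incl_def dg_hom_def dg_shifted_deg_def split: can_mor.splits nat.splits)
  qed
  show "da_morphism A11can A11can (KK \<boxtimes> LL) (KK \<boxtimes> LL) (0, - 1) KL_htpy"
    by (rule da_morphism_boundedI [OF KL_htpy_arity])
      (auto simp: KL_htpy_def dg_hom_def dg_shifted_deg_def split: if_splits)
next
  fix z as T
  assume "z \<in> da_gens (KK \<boxtimes> LL)" "dg_chain A11can (da_right (KK \<boxtimes> LL) z) as T"
    "set as \<subseteq> dg_plus A11can" "length as \<le> 0 + 1"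
  then show "mm_comp A11can (da_delta (da_identity A11can)) KL_proj z as
        + mm_comp A11can KL_proj (da_delta (KK \<boxtimes> LL)) z as + mm_mult_in A11can KL_proj z as = 0"
    unfolding KL_gens
    by (cases as rule: list_cases_upto_2;
      auto simp: A11can_chain_Cons mm_evaluate ac_simps KL_delta KL_proj_def plus_A11can
         simp del: dg_chain.simps(2) split: nat.splits)
next
  fix S as T
  assume "dg_chain A11can (da_right (da_identity A11can) S) as T"
    "set as \<subseteq> dg_plus A11can" "length as \<le> 1 + 1"
  then show "mm_comp A11can (da_delta (KK \<boxtimes> LL)) KL_incl S as
        + mm_comp A11can KL_incl (da_delta (da_identity A11can)) S as
        + mm_mult_in A11can KL_incl S as = 0"
    by (cases as rule: list_cases_upto_2; cases S;
      auto simp: A11can_chain_Cons mm_evaluate ac_simps KL_delta KL_incl_def plus_A11can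
         simp del: dg_chain.simps(2) split: nat.splits)
next
  fix z as T
  assume "z \<in> da_gens (KK \<boxtimes> LL)" "dg_chain A11can (da_right (KK \<boxtimes> LL) z) as T"
    "set as \<subseteq> dg_plus A11can" "length as \<le> 0 + 1"
  then show "mm_comp A11can (da_delta (KK \<boxtimes> LL)) KL_htpy z as
        + mm_comp A11can KL_htpy (da_delta (KK \<boxtimes> LL)) z as + mm_mult_in A11can KL_htpy z as
      = mm_comp A11can KL_incl KL_proj z as + da_mor_id A11can (KK \<boxtimes> LL) z as"
    unfolding KL_gens
    by (cases as rule: list_cases_upto_2;
      auto simp: A11can_chain_Cons mm_evaluate ac_simps KL_delta KL_proj_def KL_incl_def KL_htpy_def
          da_mor_id_def plus_A11can
         simp del: dg_chain.simps(2) split: nat.splits)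
next
  fix S as T
  assume "dg_chain A11can (da_right (da_identity A11can) S) as T"
    "set as \<subseteq> dg_plus A11can" "length as \<le> 0 + 1"
  then show "mm_comp A11can KL_proj KL_incl S as = da_mor_id A11can (da_identity A11can) S as"
    by (cases as rule: list_cases_upto_2; cases S;
      auto simp: A11can_chain_Cons mm_evaluate ac_simps KL_proj_def KL_incl_def da_mor_id_def plus_A11can
         simp del: dg_chain.simps(2) split: nat.splits)
qed simp_all

lemma LK_homotopy_equiv: "da_homotopy_equiv A11 A11 (LL \<boxtimes> KK) (da_identity A11)"
proof (rule da_homotopy_equiv_retractI [OF _ _ da_bimodule_LK LK_arity
      da_bimodule_identity [OF dg_category_A11] mm_arity_mono [OF da_identity_arity] _ _ LK_proj_arity
      _ LK_incl_arity _ LK_htpy_arity])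
  show "da_morphism A11 A11 (LL \<boxtimes> KK) (da_identity A11) (0, 0) LK_proj"
  proof (rule da_morphism_boundedI [OF LK_proj_arity])
    fix z and as :: "std_mor list"
    assume "length as \<le> 1" "LK_proj z as \<noteq> 0"
    then show "da_plus_input A11 (LL \<boxtimes> KK) z as"
      by (cases as rule: list_cases_upto_2; cases z; cases "fst z"; cases "snd z")
        (auto simp: LK_proj_def da_plus_input_def plus_A11 split: std_mor.splits)
  next
    fix z as T c y
    assume "z \<in> da_gens (LL \<boxtimes> KK)" "dg_chain A11 (da_right (LL \<boxtimes> KK) z) as T"
      "length as \<le> 1" "(c, y) \<in> Poly_Mapping.keys (LK_proj z as)"
    then show "y \<in> da_gens (da_identity A11) \<and>
        c \<in> dg_hom A11 (da_left (LL \<boxtimes> KK) z) (da_left (da_identity A11) y) \<and>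
        da_right (da_identity A11) y = T \<and>
        da_deg (LL \<boxtimes> KK) z + dg_shifted_deg A11 as + (0, 0)
          = dg_deg A11 c + da_deg (da_identity A11) y"
      unfolding LK_gens
      by (cases as rule: list_cases_upto_2;
        auto simp: LK_proj_def dg_hom_def dg_shifted_deg_def split: std_mor.splits)
  qed
  show "da_morphism A11 A11 (da_identity A11) (LL \<boxtimes> KK) (0, 0) LK_incl"
  proof (rule da_morphism_boundedI [OF LK_incl_arity])
    fix S and as :: "std_mor list"
    assume "length as \<le> 0" "LK_incl S as \<noteq> 0"
    then show "da_plus_input A11 (da_identity A11) S as"
      by (cases as rule: list_cases_upto_4; cases S)
        (auto simp: LK_incl_def da_plus_input_def plus_A11 split: std_mor.splits nat.splits)
  next
    fix S as T c z
    assume "dg_chain A11 (da_right (da_identity A11) S) as T"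
      "length as \<le> 0" "(c, z) \<in> Poly_Mapping.keys (LK_incl S as)"
    then show "z \<in> da_gens (LL \<boxtimes> KK) \<and>
        c \<in> dg_hom A11 (da_left (da_identity A11) S) (da_left (LL \<boxtimes> KK) z) \<and>
        da_right (LL \<boxtimes> KK) z = T \<and>
        da_deg (da_identity A11) S + dg_shifted_deg A11 as + (0, 0)
          = dg_deg A11 c + da_deg (LL \<boxtimes> KK) z"
      by (cases as rule: list_cases_upto_4; cases S)
        (auto simp: LK_incl_def dg_hom_def dg_shifted_deg_def split: std_mor.splits nat.splits)
  qed
  show "da_morphism A11 A11 (LL \<boxtimes> KK) (LL \<boxtimes> KK) (0, - 1) LK_htpy"
    by (rule da_morphism_boundedI [OF LK_htpy_arity])
      (auto simp: LK_htpy_def dg_hom_def dg_shifted_deg_def split: if_splits)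
next
  fix z as T
  assume "z \<in> da_gens (LL \<boxtimes> KK)" "dg_chain A11 (da_right (LL \<boxtimes> KK) z) as T"
    "set as \<subseteq> dg_plus A11" "length as \<le> 1 + 2"
  then show "mm_comp A11 (da_delta (da_identity A11)) LK_proj z as
        + mm_comp A11 LK_proj (da_delta (LL \<boxtimes> KK)) z as + mm_mult_in A11 LK_proj z as = 0"
    unfolding LK_gens
    by (cases as rule: list_cases_upto_4;
      auto simp: A11_chain_Cons mm_evaluate ac_simps LK_delta LK_proj_def plus_A11
         simp del: dg_chain.simps(2) split: nat.splits)
next
  fix S as T
  assume "dg_chain A11 (da_right (da_identity A11) S) as T"
    "set as \<subseteq> dg_plus A11" "length as \<le> 0 + 2"
  then show "mm_comp A11 (da_delta (LL \<boxtimes> KK)) LK_incl S as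
        + mm_comp A11 LK_incl (da_delta (da_identity A11)) S as
        + mm_mult_in A11 LK_incl S as = 0"
    by (cases as rule: list_cases_upto_4; cases S;
      auto simp: A11_chain_Cons mm_evaluate ac_simps LK_delta LK_incl_def plus_A11
         simp del: dg_chain.simps(2) split: nat.splits)
next
  fix z as T
  assume "z \<in> da_gens (LL \<boxtimes> KK)" "dg_chain A11 (da_right (LL \<boxtimes> KK) z) as T"
    "set as \<subseteq> dg_plus A11" "length as \<le> 0 + 2"
  then show "mm_comp A11 (da_delta (LL \<boxtimes> KK)) LK_htpy z as
        + mm_comp A11 LK_htpy (da_delta (LL \<boxtimes> KK)) z as + mm_mult_in A11 LK_htpy z as
      = mm_comp A11 LK_incl LK_proj z as + da_mor_id A11 (LL \<boxtimes> KK) z as"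
    unfolding LK_gens
    by (cases as rule: list_cases_upto_4;
      auto simp: A11_chain_Cons mm_evaluate ac_simps LK_delta LK_proj_def LK_incl_def LK_htpy_def
          da_mor_id_def plus_A11
         simp del: dg_chain.simps(2) split: nat.splits)
next
  fix S as T
  assume "dg_chain A11 (da_right (da_identity A11) S) as T"
    "set as \<subseteq> dg_plus A11" "length as \<le> 1 + 0"
  then show "mm_comp A11 LK_proj LK_incl S as = da_mor_id A11 (da_identity A11) S as"
    by (cases as rule: list_cases_upto_4; cases S;
      auto simp: A11_chain_Cons mm_evaluate ac_simps LK_proj_def LK_incl_def da_mor_id_def plus_A11
         simp del: dg_chain.simps(2) split: nat.splits)
qed simp_all


section \<open>Change of basis between the standard and the canonical basis\<close>

text \<open>A spanning family indexed by as many elements as the dimension is a basis.\<close>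
lemma is_basisI:
  fixes b :: "'s::finite \<Rightarrow> Cq ^ 'n::finite"
  assumes card: "CARD('s) = CARD('n)" and span: "\<And>i. axis i 1 \<in> vec.span (range b)"
  shows "is_basis b"
proof -
  have "cart_basis \<subseteq> vec.span (range b)"
    using span by (auto simp: cart_basis_def)
  then have UNIV: "vec.span (range b) = UNIV"
    using vec.span_mono [of cart_basis "vec.span (range b)"]
    by (simp add: vec.span_span top.extremum_unique)
  then have dim: "vec.dim (range b) = CARD('n)"
    by (metis vec.dim_span vec_dim_card)
  have "CARD('n) \<le> card (range b)"
    unfolding dim [symmetric] by (rule vec.dim_le_card') simp
  moreover have "card (range b) \<le> CARD('s)"
    by (rule card_image_le) simp
  ultimately have eq: "card (range b) = CARD('s)"
    using card by simp
  have "inj b"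
    by (rule eq_card_imp_inj_on) (use eq in auto)
  moreover have "vec.independent (range b)"
    by (rule vec.card_le_dim_spanning [of _ UNIV]) (use UNIV eq card in \<open>auto simp: card_cart_basis\<close>)
  ultimately show ?thesis
    using UNIV by (simp add: is_basis_def)
qed

lemma UNIV_ix_set: "UNIV = {{}, {Ix1}, {Ix2}, {Ix1, Ix2}}"
proof -
  have "(I :: ix set) \<in> Pow {Ix1, Ix2}" for I
    using UNIV_ix by auto
  then show ?thesis by (auto simp: Pow_insert)
qed

lemma Pow_ix [simp]:
  "Pow {Ix1} = {{}, {Ix1}}" "Pow {Ix2} = {{}, {Ix2}}"
  "Pow {Ix1, Ix2} = {{}, {Ix1}, {Ix2}, {Ix1, Ix2}}"
  by (auto simp: Pow_insert)

lemma vec_ix_eqI: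
  assumes "x $ {} = y $ {}" "x $ {Ix1} = y $ {Ix1}" "x $ {Ix2} = y $ {Ix2}"
    "x $ {Ix1, Ix2} = y $ {Ix1, Ix2}"
  shows "x = y"
proof -
  have "x $ I = y $ I" for I
    using assms UNIV_ix_set by (metis UNIV_I empty_iff insert_iff)
  then show ?thesis by (simp add: vec_eq_iff)
qed

text \<open>The sign records that coordinates refer to generators in increasing order.\<close>
lemma wedge_e2_e1: "wedge ext_e2 ext_e1 = - axis {Ix1, Ix2} 1"
proof (rule vec_ix_eqI)
  have "{(j, k). j = Ix2 \<and> (k = Ix1 \<or> k = Ix2) \<and> k \<noteq> Ix2 \<and> k < j} = {(Ix2, Ix1)}"
    by (auto simp: less_ix_def)
  moreover have "{Ix1, Ix2} - {Ix2} = {Ix1}" "{Ix1, Ix2} - {Ix1} = {Ix2}" by auto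
  ultimately show "wedge ext_e2 ext_e1 $ {Ix1, Ix2} = (- axis {Ix1, Ix2} 1) $ {Ix1, Ix2}"
    by (simp add: wedge_def ext_e1_def ext_e2_def ext_gen_def axis_def doubleton_eq_iff)
qed (simp_all add: wedge_def ext_e1_def ext_e2_def ext_gen_def axis_def doubleton_eq_iff)

lemma wedge_e1_e1: "wedge ext_e1 ext_e1 = 0"
  by (rule vec_ix_eqI)
    (simp_all add: wedge_def ext_e1_def ext_gen_def axis_def doubleton_eq_iff)

lemma wedge_add_left: "wedge (x + y) z = wedge x z + wedge y z"
  by (simp add: wedge_def vec_eq_iff sum.distrib [symmetric] algebra_simps)

lemma wedge_scale_left: "wedge (c *s x) z = c *s wedge x z"
  by (simp add: wedge_def vec_eq_iff sum_distrib_left algebra_simps)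

lemma wedge_l2_l1: "wedge can_l2 can_l1 = wedge ext_e2 ext_e1"
  by (simp add: can_l1_def can_l2_def wedge_add_left wedge_scale_left wedge_e1_e1)

lemma ket_component: "ket i j $ (k, l) = (if k = i \<and> l = j then 1 else 0)"
  by (auto simp: ket_def tensor_def axis_def)

lemma standard_basis_eq:
  "standard_basis S_uu = wedge ext_e2 ext_e1" "standard_basis S_ou = ext_e2"
  "standard_basis S_uo = ext_e1" "standard_basis S_oo = ext_one"
  by (simp_all add: V2_to_ext_def ket_component)

text \<open>Here \<open>\<ell>\<^sub>2 \<and> \<ell>\<^sub>1 = e\<^sub>2 \<and> e\<^sub>1\<close>, as \<open>e\<^sub>1 \<and> e\<^sub>1 = 0\<close>.\<close>
lemma canonical_basis_eq:
  "canonical_basis S_empty = standard_basis S_uu"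
  "canonical_basis S_A = standard_basis S_ou + qv *s standard_basis S_uo"
  "canonical_basis S_B = standard_basis S_uo"
  "canonical_basis S_AB = standard_basis S_oo"
  unfolding standard_basis_eq by (simp_all add: wedge_l2_l1) (simp_all add: can_l1_def can_l2_def)

lemma axis_standard:
  "axis I 1 \<in> {- standard_basis S_uu, standard_basis S_ou, standard_basis S_uo, standard_basis S_oo}"
proof -
  have "I \<in> {{}, {Ix1}, {Ix2}, {Ix1, Ix2}}" using UNIV_ix_set by blast
  then show ?thesis
    unfolding standard_basis_eq wedge_e2_e1
    by (auto simp: ext_one_def ext_e1_def ext_e2_def ext_gen_def)
qed

lemma card_std_obj: "CARD(std_obj) = 4"
  by (simp add: UNIV_std_obj)

lemma card_can_obj: "CARD(can_obj) = 4"
  by (simp add: UNIV_can_obj)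

lemma card_ix_set: "CARD(ix set) = 4"
  by (simp add: UNIV_ix_set doubleton_eq_iff card_insert_if)

lemma is_basis_standard: "is_basis standard_basis"
proof (rule is_basisI)
  have std: "standard_basis s \<in> vec.span (range standard_basis)" for s
    by (rule vec.span_base) simp
  show "axis I 1 \<in> vec.span (range standard_basis)" for I
    using axis_standard [of I] std vec.span_neg [OF std [of S_uu]]
    by (auto simp del: standard_basis.simps)
qed (simp only: card_std_obj card_ix_set)

lemma is_basis_canonical: "is_basis canonical_basis"
proof (rule is_basisI)
  have std: "standard_basis s \<in> vec.span (range canonical_basis)" for s
  proof -
    have can: "canonical_basis t \<in> vec.span (range canonical_basis)" for t
      by (rule vec.span_base) simp
    have "standard_basis S_ou = canonical_basis S_A - qv *s canonical_basis S_B"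
      unfolding canonical_basis_eq by simp
    then show ?thesis
      using can [of S_empty] can [of S_A] can [of S_B] can [of S_AB]
      unfolding canonical_basis_eq [symmetric]
      by (cases s) (auto simp only: canonical_basis_eq [symmetric] intro: vec.span_diff vec.span_scale)
  qed
  show "axis I 1 \<in> vec.span (range canonical_basis)" for I
    using axis_standard [of I] std vec.span_neg [OF std [of S_uu]]
    by (auto simp del: standard_basis.simps)
qed (simp only: card_can_obj card_ix_set)

lemma matrix_G0_map:
  "matrix (G0_map N) $ t $ s =
     (\<Sum>x | x \<in> ad_gens N \<and> ad_left N x = t \<and> ad_right N x = s.
        (- 1) powi snd (ad_deg N x) * qv powi fst (ad_deg N x))"
  by (simp add: matrix_def G0_map_def axis_def if_distrib cong: if_cong)

text \<open>Every entry of the two matrices is contributed by at most one generator.\<close>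
lemma fiber_KK:
  "{x. K_right x = s \<and> K_left x = t} =
     (case (s, t) of (S_uu, S_empty) \<Rightarrow> {kap1} | (S_ou, S_A) \<Rightarrow> {kap2} | (S_uo, S_A) \<Rightarrow> {kap3}
       | (S_uo, S_B) \<Rightarrow> {kap4} | (S_oo, S_AB) \<Rightarrow> {kap5} | _ \<Rightarrow> {})" (is "?L = ?R")
proof -
  have "x \<in> ?L \<longleftrightarrow> x \<in> ?R" for x by (cases s; cases t; cases x) auto
  then show ?thesis by blast
qed

lemma fiber_LL:
  "{x. L_right x = t \<and> L_left x = s} =
     (case (s, t) of (S_uu, S_empty) \<Rightarrow> {lam1} | (S_ou, S_A) \<Rightarrow> {lam2} | (S_ou, S_B) \<Rightarrow> {lam3}
       | (S_uo, S_B) \<Rightarrow> {lam4} | (S_oo, S_AB) \<Rightarrow> {lam5} | _ \<Rightarrow> {})" (is "?L = ?R")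
proof -
  have "x \<in> ?L \<longleftrightarrow> x \<in> ?R" for x by (cases s; cases t; cases x) auto
  then show ?thesis by blast
qed

lemma matrix_dual_KK:
  "matrix (G0_map (left_dual KK)) =
        (\<chi> s t. [[1, 0, 0, 0],
                 [0, 1, 0, 0],
                 [0, qv, 1, 0],
                 [0, 0, 0, 1]] ! std_pos s ! can_pos t)" (is "?M = ?R")
proof -
  have "?M $ s $ t = ?R $ s $ t" for s t
    by (cases s; cases t) (simp_all add: matrix_G0_map left_dual_def fiber_KK eval_nat_numeral)
  then show ?thesis by (simp only: vec_eq_iff) blast
qed

lemma matrix_dual_LL:
  "matrix (G0_map (left_dual LL)) =
        (\<chi> t s. [[1, 0, 0, 0],
                 [0, 1, 0, 0],
                 [0, - qv, 1, 0],
                 [0, 0, 0, 1]] ! can_pos t ! std_pos s)" (is "?M = ?R")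
proof -
  have "?M $ t $ s = ?R $ t $ s" for s t
    by (cases s; cases t) (simp_all add: matrix_G0_map left_dual_def fiber_LL eval_nat_numeral)
  then show ?thesis by (simp only: vec_eq_iff) blast
qed

lemma change_of_basis_KK:
  "change_of_basis_matrix canonical_basis standard_basis (matrix (G0_map (left_dual KK)))"
proof -
  have "canonical_basis t = (\<Sum>s\<in>UNIV. matrix (G0_map (left_dual KK)) $ s $ t *s standard_basis s)"
    for t
    by (cases t) (simp_all add: canonical_basis_eq matrix_dual_KK UNIV_std_obj eval_nat_numeral
        del: canonical_basis.simps standard_basis.simps)
  then show ?thesis
    by (simp add: change_of_basis_matrix_def is_basis_standard is_basis_canonical
        del: canonical_basis.simps standard_basis.simps)
qed

lemma change_of_basis_LL:
  "change_of_basis_matrix standard_basis canonical_basis (matrix (G0_map (left_dual LL)))"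
proof -
  have "standard_basis s = (\<Sum>t\<in>UNIV. matrix (G0_map (left_dual LL)) $ t $ s *s canonical_basis t)"
    for s
    by (cases s) (simp_all add: canonical_basis_eq matrix_dual_LL UNIV_can_obj eval_nat_numeral
        del: canonical_basis.simps standard_basis.simps)
  then show ?thesis
    by (simp add: change_of_basis_matrix_def is_basis_standard is_basis_canonical
        del: canonical_basis.simps standard_basis.simps)
qed


theorem theorem1p13:
  shows "da_bimodule A11can A11 KK \<and> da_bimodule A11 A11can LL
    \<and> box_defined A11can KK LL \<and> da_homotopy_equiv A11can A11can (KK \<boxtimes> LL) (da_identity A11can)
    \<and> box_defined A11 LL KK \<and> da_homotopy_equiv A11 A11 (LL \<boxtimes> KK) (da_identity A11)
    \<and> change_of_basis_matrix canonical_basis standard_basis (matrix (G0_map (left_dual KK)))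
    \<and> change_of_basis_matrix standard_basis canonical_basis (matrix (G0_map (left_dual LL)))
    \<and> matrix (G0_map (left_dual KK)) =
        (\<chi> s t. [[1, 0, 0, 0],
                 [0, 1, 0, 0],
                 [0, qv, 1, 0],
                 [0, 0, 0, 1]] ! std_pos s ! can_pos t)
    \<and> matrix (G0_map (left_dual LL)) =
        (\<chi> t s. [[1, 0, 0, 0],
                 [0, 1, 0, 0],
                 [0, - qv, 1, 0],
                 [0, 0, 0, 1]] ! can_pos t ! std_pos s)"
  using da_bimodule_KK da_bimodule_LL box_defined_arity [OF KK_arity] KL_homotopy_equiv
    box_defined_arity [OF LL_arity] LK_homotopy_equiv change_of_basis_KK change_of_basis_LL
    matrix_dual_KK matrix_dual_LL
  by (intro conjI)

end
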